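(* Let $W$ be a quasi-balanced weighing matrix such that $|W|$ is the adjacency matrix $A$ of a strongly regular graph with parameters $(v,k,\lambda,\mu)$, and let $k>s>t$ be the distinct eigenvalues of this graph. Write $W=W_1-W_2$ with $W_1,W_2$ disjoint $(0,1)$-matrices (so $A=W_1+W_2$), and let $\Pi=\begin{pmatrix}0&1\\1&0\end{pmatrix}$. Define the $4v\times 4v$ matrices $$A_0=\begin{pmatrix} I_2\otimes I_v&0\\0&I_2\otimes I_v\end{pmatrix},\quad A_1=\begin{pmatrix} \Pi\otimes I_v&0\\0&\Pi\otimes I_v\end{pmatrix},\quad A_2=\begin{pmatrix} J_2\otimes A&0\\0&J_2\otimes A\end{pmatrix},$$ $$A_3=\begin{pmatrix} J_2\otimes (J_v-I_v-A)&0\\0&J_2\otimes (J_v-I_v-A)\end{pmatrix},\quad A_4=\begin{pmatrix}0&J_2\otimes I_v\\ J_2\otimes I_v&0\end{pmatrix},$$ $$A_5=\begin{pmatrix}0&I_2\otimes W_1+\Pi\otimes W_2\\ I_2\otimes W_1^\top+\Pi\otimes W_2^\top&0\end{pmatrix},\quad A_6=\begin{pmatrix}0&I_2\otimes W_2+\Pi\otimes W_1\\ I_2\otimes W_2^\top+\Pi\otimes W_1^\top&0\end{pmatrix},$$ $$A_7=\begin{pmatrix}0&J_2\otimes(J_v-I_v-A)\\ J_2\otimes(J_v-I_v-A)&0\end{pmatrix}.$$ Then $\{A_i\}_{i=0}^7$ is a (symmetric, 7-class) association scheme whose first and second eigenmatrices $P$ and $Q$ (for a suitable ordering of the primitive idempotents)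 are $$P=\begin{pmatrix} 1 & 1 & 2 k & -\frac{2 k (s+1) (t+1)}{k+s t} & 2 & k & k & -\frac{2 k (s+1) (t+1)}{k+s t} \\ 1 & 1 & 2 k & -\frac{2 k (s+1) (t+1)}{k+s t} & -2 & -k & -k & \frac{2 k (s+1) (t+1)}{k+s t} \\ 1 & 1 & 2 s & -2 (s+1) & 2 & s & s & -2 (s+1) \\ 1 & 1 & 2 s & -2 (s+1) & -2 & -s & -s & 2 (s+1) \\ 1 & 1 & 2 t & -2 (t+1) & 2 & t & t & -2 (t+1) \\ 1 & 1 & 2 t & -2 (t+1) & -2 & -t & -t & 2 (t+1) \\ 1 & -1 & 0 & 0 & 0 & \sqrt{k} & -\sqrt{k} & 0 \\ 1 & -1 & 0 & 0 & 0 & -\sqrt{k} & \sqrt{k} & 0 \end{pmatrix},$$ $$Q=\begin{pmatrix} 1 & 1 & \frac{k (k-t) (t+1)}{(t-s) (k+s t)} & \frac{k (k-t) (t+1)}{(t-s) (k+s t)} & \frac{k (k-s) (s+1)}{(s-t) (k+s t)} & \frac{k (k-s) (s+1)}{(s-t) (k+s t)} & \frac{(k-s) (k-t)}{k+s t} & \frac{(k-s) (k-t)}{k+s t} \\ 1 & 1 & \frac{k (k-t) (t+1)}{(t-s) (k+s t)} & \frac{k (k-t) (t+1)}{(t-s) (k+s t)} & \frac{k (k-s) (s+1)}{(s-t) (k+s t)} & \frac{k (k-s) (s+1)}{(s-t) (k+s t)} & -\frac{(k-s) (k-t)}{k+s t} & -\frac{(k-s) (k-t)}{k+s t} \\ 1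 & 1 & \frac{s (t+1) (t-k)}{(s-t) (k+s t)} & \frac{s (t+1) (t-k)}{(s-t) (k+s t)} & \frac{(k-s) (s+1) t}{(s-t) (k+s t)} & \frac{(k-s) (s+1) t}{(s-t) (k+s t)} & 0 & 0 \\ 1 & 1 & \frac{t-k}{s-t} & \frac{t-k}{s-t} & \frac{k-s}{s-t} & \frac{k-s}{s-t} & 0 & 0 \\ 1 & -1 & \frac{k (k-t) (t+1)}{(t-s) (k+s t)} & \frac{k (k-t) (t+1)}{(s-t) (k+s t)} & \frac{k (k-s) (s+1)}{(s-t) (k+s t)} & -\frac{k (k-s) (s+1)}{(s-t) (k+s t)} & 0 & 0 \\ 1 & -1 & \frac{s (t+1) (t-k)}{(s-t) (k+s t)} & \frac{s (k-t) (t+1)}{(s-t) (k+s t)} & \frac{(k-s) (s+1) t}{(s-t) (k+s t)} & -\frac{(k-s) (s+1) t}{(s-t) (k+s t)} & \frac{(k-s) (k-t)}{\sqrt{k} (k+s t)} & -\frac{(k-s) (k-t)}{\sqrt{k} (k+s t)} \\ 1 & -1 & \frac{s (t+1) (t-k)}{(s-t) (k+s t)} & \frac{s (k-t) (t+1)}{(s-t) (k+s t)} & \frac{(k-s) (s+1) t}{(s-t) (k+s t)} & -\frac{(k-s) (s+1) t}{(s-t) (k+s t)} & -\frac{(k-s) (k-t)}{\sqrt{k} (k+s t)} & \frac{(k-s) (k-t)}{\sqrt{k} (k+s t)} \\ 1 & -1 & \frac{t-k}{s-t} & \frac{k-t}{s-t} & \frac{k-s}{s-t} & \frac{s-k}{s-t}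 & 0 & 0 \end{pmatrix}.$$
   Context: $I_r$, $J_r$ are the identity and all-ones matrices of order $r$. A weighing matrix of order $v$ and weight $k$ is a $v\times v$ matrix $W$ with entries in $\{0,1,-1\}$ satisfying $WW^\top=kI_v$. $|W|$ is its entrywise absolute value. $W$ is quasi-balanced if $|W|\,|W|^\top=|W|^\top|W|$ and the off-diagonal entries of $|W|\,|W|^\top$ take at most two distinct values. Two $(0,1)$-matrices are disjoint if no position is nonzero in both. A graph (simple, undirected) on $v$ vertices with adjacency matrix $A$ is strongly regular with parameters $(v,k,\lambda,\mu)$ if $A^2=kI_v+\lambda A+\mu(J_v-I_v-A)$; here $A\neq0$ and $J_v-I_v-A\ne 0$ (strongly regular graphs are those for which $\{I,A,J-I-A\}$ is a 2-class association scheme). A symmetric association scheme with $d$ classes on a finite set $X$ is a set of nonzero $(0,1)$-matrices $A_0,\dots,A_d$ indexed by $X$ with $A_0=I$, $\sum_i A_i=J$, $A_i^\top=A_i$, and $A_iA_j=\sum_{h} p_{ij}^hA_h$ for non-negative integers $p_{ij}^h$. Its Bose–Mesner algebra (the complex span of the $A_i$) has a basis of primitive idempotents $E_0=\frac1{|X|}J,E_1,\dots,E_d$, and the first and second eigenmatrices $P,Q$ (rows and columns indexed from $0$ to $d$) are defined by $A_j=\sum_i P_{ij}E_i$ and $E_j=\frac1{|X|}\sum_i Q_{ij}A_i$. *)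

theory Defs
  imports "Jordan_Normal_Form.Spectral_Radius"
begin

text \<open>
  All matrices are Jordan_Normal_Form matrices: rows and columns are numbered from 0, and the
  finite set indexing a matrix of order n is the set of naturals below n.  (0,1)-matrices and
  weighing matrices are integer matrices; eigenvalues, Bose-Mesner algebras and eigenmatrices live
  over the complex numbers, into which integer matrices are embedded entrywise.
\<close>

definition all_ones :: "nat \<Rightarrow> 'a::one mat" where
  "all_ones r = mat r r (\<lambda>_. 1)"

definition swap2 :: "'a::zero_neq_one mat" where
  "swap2 = mat_of_rows_list 2 [[0, 1], [1, 0]]"

definition kronecker :: "'a::times mat \<Rightarrow> 'a mat \<Rightarrow> 'a mat" where
  "kronecker A B = mat (dim_row A * dim_row B) (dim_col A * dim_col B)
     (\<lambda>(i, j). A $$ (i div dim_row B, j div dim_col B) * B $$ (i mod dim_row B, j mod dim_col B))"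

abbreviation complex_mat :: "int mat \<Rightarrow> complex mat" where
  "complex_mat \<equiv> map_mat complex_of_int"

definition abs_mat :: "int mat \<Rightarrow> int mat" where
  "abs_mat W = map_mat abs W"

definition zero_one_matrix :: "nat \<Rightarrow> int mat \<Rightarrow> bool" where
  "zero_one_matrix n M \<longleftrightarrow> M \<in> carrier_mat n n \<and> elements_mat M \<subseteq> {0, 1}"

definition disjoint_matrices :: "nat \<Rightarrow> int mat \<Rightarrow> int mat \<Rightarrow> bool" where
  "disjoint_matrices n M N \<longleftrightarrow> \<not> (\<exists>i<n. \<exists>j<n. M $$ (i, j) \<noteq> 0 \<and> N $$ (i, j) \<noteq> 0)"

definition weighing_matrix :: "nat \<Rightarrow> nat \<Rightarrow> int mat \<Rightarrow> bool" where
  "weighing_matrix v k W \<longleftrightarrow>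
     W \<in> carrier_mat v v \<and> elements_mat W \<subseteq> {0, 1, -1} \<and>
     W * transpose_mat W = int k \<cdot>\<^sub>m 1\<^sub>m v"

definition quasi_balanced :: "nat \<Rightarrow> int mat \<Rightarrow> bool" where
  "quasi_balanced v W \<longleftrightarrow>
     abs_mat W * transpose_mat (abs_mat W) = transpose_mat (abs_mat W) * abs_mat W \<and>
     card {(abs_mat W * transpose_mat (abs_mat W)) $$ (i, j) | i j. i < v \<and> j < v \<and> i \<noteq> j} \<le> 2"

definition simple_graph :: "nat \<Rightarrow> (nat \<times> nat) set \<Rightarrow> bool" where
  "simple_graph v G \<longleftrightarrow> G \<subseteq> {0..<v} \<times> {0..<v} \<and> sym G \<and> irrefl G"

definition adjacency_matrix :: "nat \<Rightarrow> (nat \<times> nat) set \<Rightarrow> int mat" where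
  "adjacency_matrix v G = mat v v (\<lambda>(i, j). if (i, j) \<in> G then 1 else 0)"

definition strongly_regular_graph ::
  "nat \<Rightarrow> nat \<Rightarrow> nat \<Rightarrow> nat \<Rightarrow> (nat \<times> nat) set \<Rightarrow> bool" where
  "strongly_regular_graph v k l m G \<longleftrightarrow>
     simple_graph v G \<and>
     (let A = adjacency_matrix v G; C = all_ones v - 1\<^sub>m v - A in
        A * A = int k \<cdot>\<^sub>m 1\<^sub>m v + int l \<cdot>\<^sub>m A + int m \<cdot>\<^sub>m C \<and>
        A \<noteq> 0\<^sub>m v v \<and> C \<noteq> 0\<^sub>m v v)"

text \<open>Linear combinations of a family of matrices of order n indexed from 0 to d.\<close>

definition mat_lincomb :: "nat \<Rightarrow> nat \<Rightarrow> (nat \<Rightarrow> 'a) \<Rightarrow> (nat \<Rightarrow> 'a::comm_ring_1 mat) \<Rightarrow> 'a mat" where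
  "mat_lincomb n d c M = mat n n (\<lambda>(x, y). \<Sum>h\<le>d. c h * M h $$ (x, y))"

definition mat_span :: "nat \<Rightarrow> nat \<Rightarrow> (nat \<Rightarrow> 'a::comm_ring_1 mat) \<Rightarrow> 'a mat set" where
  "mat_span n d M = {mat_lincomb n d c M | c. True}"

definition symmetric_association_scheme :: "nat \<Rightarrow> nat \<Rightarrow> (nat \<Rightarrow> int mat) \<Rightarrow> bool" where
  "symmetric_association_scheme n d A \<longleftrightarrow>
     (\<forall>i\<le>d. zero_one_matrix n (A i) \<and> A i \<noteq> 0\<^sub>m n n) \<and>
     A 0 = 1\<^sub>m n \<and>
     mat_lincomb n d (\<lambda>_. 1) A = all_ones n \<and>
     (\<forall>i\<le>d. transpose_mat (A i) = A i) \<and>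
     (\<exists>p :: nat \<Rightarrow> nat \<Rightarrow> nat \<Rightarrow> nat. \<forall>i\<le>d. \<forall>j\<le>d.
        A i * A j = mat_lincomb n d (\<lambda>h. int (p i j h)) A)"

definition bose_mesner :: "nat \<Rightarrow> nat \<Rightarrow> (nat \<Rightarrow> int mat) \<Rightarrow> complex mat set" where
  "bose_mesner n d A = mat_span n d (\<lambda>i. complex_mat (A i))"

definition idempotent_of :: "complex mat set \<Rightarrow> complex mat \<Rightarrow> bool" where
  "idempotent_of \<A> e \<longleftrightarrow> e \<in> \<A> \<and> e * e = e"

definition primitive_idempotent :: "nat \<Rightarrow> complex mat set \<Rightarrow> complex mat \<Rightarrow> bool" where
  "primitive_idempotent n \<A> e \<longleftrightarrow>
     idempotent_of \<A> e \<and> e \<noteq> 0\<^sub>m n n \<and>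
     (\<forall>f g. idempotent_of \<A> f \<and> idempotent_of \<A> g \<and> f * g = 0\<^sub>m n n \<and> g * f = 0\<^sub>m n n \<and>
        e = f + g \<longrightarrow> f = 0\<^sub>m n n \<or> g = 0\<^sub>m n n)"

definition basis_of :: "nat \<Rightarrow> nat \<Rightarrow> complex mat set \<Rightarrow> (nat \<Rightarrow> complex mat) \<Rightarrow> bool" where
  "basis_of n d \<A> E \<longleftrightarrow>
     (\<forall>i\<le>d. E i \<in> carrier_mat n n) \<and>
     mat_span n d E = \<A> \<and>
     (\<forall>c. mat_lincomb n d c E = 0\<^sub>m n n \<longrightarrow> (\<forall>i\<le>d. c i = 0))"

text \<open>An ordering of the primitive idempotents; only the position of J/n is prescribed.\<close>

definition primitive_idempotent_basis ::
  "nat \<Rightarrow> nat \<Rightarrow> (nat \<Rightarrow> int mat) \<Rightarrow> (nat \<Rightarrow> complex mat) \<Rightarrow> bool" where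
  "primitive_idempotent_basis n d A E \<longleftrightarrow>
     E 0 = (1 / of_nat n) \<cdot>\<^sub>m all_ones n \<and>
     (\<forall>i\<le>d. primitive_idempotent n (bose_mesner n d A) (E i)) \<and>
     basis_of n d (bose_mesner n d A) E"

definition first_eigenmatrix ::
  "nat \<Rightarrow> nat \<Rightarrow> (nat \<Rightarrow> int mat) \<Rightarrow> (nat \<Rightarrow> complex mat) \<Rightarrow> complex mat \<Rightarrow> bool" where
  "first_eigenmatrix n d A E P \<longleftrightarrow>
     P \<in> carrier_mat (d + 1) (d + 1) \<and>
     (\<forall>j\<le>d. complex_mat (A j) = mat_lincomb n d (\<lambda>i. P $$ (i, j)) E)"

definition second_eigenmatrix ::
  "nat \<Rightarrow> nat \<Rightarrow> (nat \<Rightarrow> int mat) \<Rightarrow> (nat \<Rightarrow> complex mat) \<Rightarrow> complex mat \<Rightarrow> bool" where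
  "second_eigenmatrix n d A E Q \<longleftrightarrow>
     Q \<in> carrier_mat (d + 1) (d + 1) \<and>
     (\<forall>j\<le>d. E j =
        (1 / of_nat n) \<cdot>\<^sub>m mat_lincomb n d (\<lambda>i. Q $$ (i, j)) (\<lambda>i. complex_mat (A i)))"

definition scheme_matrices ::
  "nat \<Rightarrow> int mat \<Rightarrow> int mat \<Rightarrow> int mat \<Rightarrow> nat \<Rightarrow> int mat" where
  "scheme_matrices v A W1 W2 i =
    (let I2 = 1\<^sub>m 2; J2 = all_ones 2; Iv = 1\<^sub>m v;
         C = all_ones v - 1\<^sub>m v - A;
         Z = 0\<^sub>m (2 * v) (2 * v) in
     [ four_block_mat (kronecker I2 Iv) Z Z (kronecker I2 Iv),
       four_block_mat (kronecker swap2 Iv) Z Z (kronecker swap2 Iv),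
       four_block_mat (kronecker J2 A) Z Z (kronecker J2 A),
       four_block_mat (kronecker J2 C) Z Z (kronecker J2 C),
       four_block_mat Z (kronecker J2 Iv) (kronecker J2 Iv) Z,
       four_block_mat Z
         (kronecker I2 W1 + kronecker swap2 W2)
         (kronecker I2 (transpose_mat W1) + kronecker swap2 (transpose_mat W2)) Z,
       four_block_mat Z
         (kronecker I2 W2 + kronecker swap2 W1)
         (kronecker I2 (transpose_mat W2) + kronecker swap2 (transpose_mat W1)) Z,
       four_block_mat Z (kronecker J2 C) (kronecker J2 C) Z ] ! i)"

definition scheme_P :: "real \<Rightarrow> real \<Rightarrow> real \<Rightarrow> real mat" where
  "scheme_P k s t = mat_of_rows_list 8
   [[1, 1, 2 * k, - (2 * k * (s + 1) * (t + 1) / (k + s * t)),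
     2, k, k, - (2 * k * (s + 1) * (t + 1) / (k + s * t))],
    [1, 1, 2 * k, - (2 * k * (s + 1) * (t + 1) / (k + s * t)),
     -2, -k, -k, 2 * k * (s + 1) * (t + 1) / (k + s * t)],
    [1, 1, 2 * s, -2 * (s + 1), 2, s, s, -2 * (s + 1)],
    [1, 1, 2 * s, -2 * (s + 1), -2, -s, -s, 2 * (s + 1)],
    [1, 1, 2 * t, -2 * (t + 1), 2, t, t, -2 * (t + 1)],
    [1, 1, 2 * t, -2 * (t + 1), -2, -t, -t, 2 * (t + 1)],
    [1, -1, 0, 0, 0, sqrt k, - sqrt k, 0],
    [1, -1, 0, 0, 0, - sqrt k, sqrt k, 0]]"

definition scheme_Q :: "real \<Rightarrow> real \<Rightarrow> real \<Rightarrow> real mat" where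
  "scheme_Q k s t = mat_of_rows_list 8
   [[1, 1,
     k * (k - t) * (t + 1) / ((t - s) * (k + s * t)), k * (k - t) * (t + 1) / ((t - s) * (k + s * t)),
     k * (k - s) * (s + 1) / ((s - t) * (k + s * t)), k * (k - s) * (s + 1) / ((s - t) * (k + s * t)),
     (k - s) * (k - t) / (k + s * t), (k - s) * (k - t) / (k + s * t)],
    [1, 1,
     k * (k - t) * (t + 1) / ((t - s) * (k + s * t)), k * (k - t) * (t + 1) / ((t - s) * (k + s * t)),
     k * (k - s) * (s + 1) / ((s - t) * (k + s * t)), k * (k - s) * (s + 1) / ((s - t) * (k + s * t)),
     - ((k - s) * (k - t) / (k + s * t)), - ((k - s) * (k - t) / (k + s * t))],
    [1, 1,
     s * (t + 1) * (t - k) / ((s - t) * (k + s * t)), s * (t + 1) * (t - k) / ((s - t) * (k + s * t)),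
     (k - s) * (s + 1) * t / ((s - t) * (k + s * t)), (k - s) * (s + 1) * t / ((s - t) * (k + s * t)),
     0, 0],
    [1, 1,
     (t - k) / (s - t), (t - k) / (s - t),
     (k - s) / (s - t), (k - s) / (s - t),
     0, 0],
    [1, -1,
     k * (k - t) * (t + 1) / ((t - s) * (k + s * t)), k * (k - t) * (t + 1) / ((s - t) * (k + s * t)),
     k * (k - s) * (s + 1) / ((s - t) * (k + s * t)), - (k * (k - s) * (s + 1) / ((s - t) * (k + s * t))),
     0, 0],
    [1, -1,
     s * (t + 1) * (t - k) / ((s - t) * (k + s * t)), s * (k - t) * (t + 1) / ((s - t) * (k + s * t)),
     (k - s) * (s + 1) * t / ((s - t) * (k + s * t)), - ((k - s) * (s + 1) * t / ((s - t) * (k + s * t))),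
     (k - s) * (k - t) / (sqrt k * (k + s * t)), - ((k - s) * (k - t) / (sqrt k * (k + s * t)))],
    [1, -1,
     s * (t + 1) * (t - k) / ((s - t) * (k + s * t)), s * (k - t) * (t + 1) / ((s - t) * (k + s * t)),
     (k - s) * (s + 1) * t / ((s - t) * (k + s * t)), - ((k - s) * (s + 1) * t / ((s - t) * (k + s * t))),
     - ((k - s) * (k - t) / (sqrt k * (k + s * t))), (k - s) * (k - t) / (sqrt k * (k + s * t))],
    [1, -1,
     (t - k) / (s - t), (k - t) / (s - t),
     (k - s) / (s - t), (s - k) / (s - t),
     0, 0]]"

end

theory Submission
  imports Defs
begin

text \<open>
  Write R for A_0 - A_1 and D for A_5 - A_6. Since W has inverse (1/k) W^T, the matrices R and D
  satisfy R^2 = 2R, RD = DR = 2D and D^2 = 2kR, and both annihilate every matrix with blocks of the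
  form J_2 (x) M. Hence the span of the A_i is closed under multiplication, and its idempotents are
  the (F_i (x) J_2)/2 spread symmetrically or antisymmetrically over the two halves, where F_i are
  the idempotents of the strongly regular graph, together with (R + D/sqrt k)/4 and
  (R - D/sqrt k)/4. The intersection numbers are then automatically non-negative integers, because
  each is an entry of some A_i A_j.
\<close>

section \<open>Schemes from orthogonal idempotents\<close>

text \<open>W is not assumed symmetric, and no rule for AW or WA is used: A always sits beside J_2
  and W beside I_2 - Pi, and J_2 (I_2 - Pi) = 0, so these products never arise. What remains has
  dimension 8: six dimensions for I, A, J on and off the diagonal halves, two for R and D. Every
  check becomes an identity between coordinate vectors of length 8. Closure is not verified on the
  products A_i A_j one by one. It follows from the orthogonality of the E_i together with the two
  changes of basis P and Q. The entries of P and Q carry the denominator k + st. By Vieta this is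
  the parameter mu, and counting gives mu v = (k - s)(k - t); trading k + st for v turns those
  entries into expressions with denominators s - t and sqrt k only. The root occurs because D/2
  squares to k on the range of R.\<close>

lemma mat_lincomb_carrier [simp]: "mat_lincomb n d c M \<in> carrier_mat n n"
  by (simp add: mat_lincomb_def)

lemma mat_lincomb_dim [simp]:
  "dim_row (mat_lincomb n d c M) = n" "dim_col (mat_lincomb n d c M) = n"
  by (simp_all add: mat_lincomb_def)

lemma mat_lincomb_index [simp]:
  "x < n \<Longrightarrow> y < n \<Longrightarrow> mat_lincomb n d c M $$ (x, y) = (\<Sum>h\<le>d. c h * M h $$ (x, y))"
  by (simp add: mat_lincomb_def)

lemma mat_lincomb_single:
  assumes "i \<le> d" "M i \<in> carrier_mat n n"
  shows "mat_lincomb n d (\<lambda>h. if h = i then c else 0) M = c \<cdot>\<^sub>m M i"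
proof (rule eq_matI)
  fix x y assume "x < dim_row (c \<cdot>\<^sub>m M i)" "y < dim_col (c \<cdot>\<^sub>m M i)"
  then have xy: "x < n" "y < n" using assms by auto
  have "(\<Sum>h\<le>d. (if h = i then c else 0) * M h $$ (x, y))
    = (\<Sum>h\<le>d. if h = i then c * M i $$ (x, y) else 0)"
    by (rule sum.cong) auto
  then show "mat_lincomb n d (\<lambda>h. if h = i then c else 0) M $$ (x, y) = (c \<cdot>\<^sub>m M i) $$ (x, y)"
    using xy assms by auto
qed (use assms in auto)

lemma mat_lincomb_mat_lincomb:
  assumes "\<And>i. i \<le> d \<Longrightarrow> E i = mat_lincomb n d (Q i) A"
  shows "mat_lincomb n d c E = mat_lincomb n d (\<lambda>h. \<Sum>i\<le>d. c i * Q i h) A"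
proof (rule eq_matI)
  fix x y assume "x < dim_row (mat_lincomb n d (\<lambda>h. \<Sum>i\<le>d. c i * Q i h) A)"
    "y < dim_col (mat_lincomb n d (\<lambda>h. \<Sum>i\<le>d. c i * Q i h) A)"
  then have xy: "x < n" "y < n" by auto
  have "(\<Sum>i\<le>d. c i * E i $$ (x, y)) = (\<Sum>i\<le>d. \<Sum>h\<le>d. c i * Q i h * A h $$ (x, y))"
    using assms xy by (intro sum.cong) (auto simp: sum_distrib_left mult.assoc)
  also have "\<dots> = (\<Sum>h\<le>d. (\<Sum>i\<le>d. c i * Q i h) * A h $$ (x, y))"
    by (subst sum.swap) (simp add: sum_distrib_right)
  finally show "mat_lincomb n d c E $$ (x, y)
    = mat_lincomb n d (\<lambda>h. \<Sum>i\<le>d. c i * Q i h) A $$ (x, y)" using xy by simp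
qed auto

lemma mat_span_eqI:
  assumes "\<And>i. i \<le> d \<Longrightarrow> E i = mat_lincomb n d (Q i) A"
    and "\<And>i. i \<le> d \<Longrightarrow> A i = mat_lincomb n d (P i) E"
  shows "mat_span n d E = mat_span n d A"
proof -
  have "mat_lincomb n d c E = mat_lincomb n d (\<lambda>h. \<Sum>i\<le>d. c i * Q i h) A" for c
    by (rule mat_lincomb_mat_lincomb) (rule assms(1))
  moreover have "mat_lincomb n d c A = mat_lincomb n d (\<lambda>h. \<Sum>i\<le>d. c i * P i h) E" for c
    by (rule mat_lincomb_mat_lincomb) (rule assms(2))
  ultimately show ?thesis unfolding mat_span_def by blast
qed

lemma mat_lincomb_times:
  assumes "\<And>i. i \<le> d \<Longrightarrow> E i \<in> carrier_mat n n" and M: "M \<in> carrier_mat n n"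
  shows "mat_lincomb n d c E * M = mat_lincomb n d c (\<lambda>i. E i * M)"
proof (rule eq_matI)
  fix x y assume "x < dim_row (mat_lincomb n d c (\<lambda>i. E i * M))"
    "y < dim_col (mat_lincomb n d c (\<lambda>i. E i * M))"
  then have xy: "x < n" "y < n" by auto
  have "(mat_lincomb n d c E * M) $$ (x, y) = (\<Sum>z<n. (\<Sum>i\<le>d. c i * E i $$ (x, z)) * M $$ (z, y))"
    using xy M by (auto simp: scalar_prod_def lessThan_atLeast0)
  also have "\<dots> = (\<Sum>i\<le>d. c i * (\<Sum>z<n. E i $$ (x, z) * M $$ (z, y)))"
    by (subst sum_distrib_right, subst sum.swap) (simp add: sum_distrib_left mult.assoc)
  also have "\<dots> = (\<Sum>i\<le>d. c i * (E i * M) $$ (x, y))"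
    using xy M carrier_matD[OF assms(1)]
    by (intro sum.cong) (auto simp: scalar_prod_def lessThan_atLeast0)
  finally show "(mat_lincomb n d c E * M) $$ (x, y) = mat_lincomb n d c (\<lambda>i. E i * M) $$ (x, y)"
    using xy by simp
qed (use M in auto)

text \<open>Only the term with index \<open>j\<close> survives, so the coefficient of
  \<open>E j\<close> is an eigenvalue. This one fact yields the independence and primitivity of the
  \<open>E j\<close>, and later A_i E_h = P_hi E_h.\<close>

lemma mat_lincomb_times_idempotent:
  fixes E :: "nat \<Rightarrow> 'a::comm_ring_1 mat"
  assumes car: "\<And>i. i \<le> d \<Longrightarrow> E i \<in> carrier_mat n n"
    and orth: "\<And>i j. i \<le> d \<Longrightarrow> j \<le> d \<Longrightarrow> E i * E j = (if i = j then E i else 0\<^sub>m n n)"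
    and j: "j \<le> d"
  shows "mat_lincomb n d c E * E j = c j \<cdot>\<^sub>m E j"
proof -
  have "mat_lincomb n d c E * E j = mat_lincomb n d c (\<lambda>i. E i * E j)"
    by (rule mat_lincomb_times) (use car j in auto)
  also have "\<dots> = mat_lincomb n d (\<lambda>h. if h = j then c j else 0) (\<lambda>i. E i * E j)"
    unfolding mat_lincomb_def using orth j
    by (auto intro!: cong_mat sum.cong)
  also have "\<dots> = c j \<cdot>\<^sub>m (E j * E j)"
    by (rule mat_lincomb_single) (use car[OF j] mult_carrier_mat j in auto)
  finally show ?thesis using orth j by simp
qed

lemma smult_mat_eq_0:
  assumes "(c :: 'a::idom) \<cdot>\<^sub>m M = 0\<^sub>m n n" "M \<in> carrier_mat n n" "M \<noteq> 0\<^sub>m n n"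
  shows "c = 0"
proof -
  obtain x y where "x < n" "y < n" "M $$ (x, y) \<noteq> 0"
    using assms(2,3) by (metis carrier_matD eq_matI index_zero_mat)
  moreover have "(c \<cdot>\<^sub>m M) $$ (x, y) = 0" using assms(1) calculation by simp
  ultimately show ?thesis using assms(2) by auto
qed

text \<open>If \<open>E i = f + g\<close> with \<open>f\<close> and \<open>g\<close> orthogonal
  idempotents, then \<open>f = f * E i\<close> is a scalar multiple of \<open>E i\<close>, and
  idempotency forces the scalar to be 0 or 1.\<close>

lemma primitive_idempotent_orthogonal_basis:
  assumes car: "\<And>i. i \<le> d \<Longrightarrow> E i \<in> carrier_mat n n"
    and orth: "\<And>i j. i \<le> d \<Longrightarrow> j \<le> d \<Longrightarrow> E i * E j = (if i = j then E i else 0\<^sub>m n n)"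
    and nz: "\<And>i. i \<le> d \<Longrightarrow> E i \<noteq> 0\<^sub>m n n"
    and i: "i \<le> d"
  shows "primitive_idempotent n (mat_span n d E) (E i)"
  unfolding primitive_idempotent_def
proof (intro conjI allI impI)
  have "E i = mat_lincomb n d (\<lambda>h. if h = i then 1 else 0) E"
    by (subst mat_lincomb_single) (use car i in auto)
  then have "E i \<in> mat_span n d E" unfolding mat_span_def by blast
  then show "idempotent_of (mat_span n d E) (E i)"
    unfolding idempotent_of_def using orth i by simp
  show "E i \<noteq> 0\<^sub>m n n" using nz i .
  fix f g assume H: "idempotent_of (mat_span n d E) f \<and> idempotent_of (mat_span n d E) g \<and>
    f * g = 0\<^sub>m n n \<and> g * f = 0\<^sub>m n n \<and> E i = f + g"
  obtain c where fc: "f = mat_lincomb n d c E" using H unfolding idempotent_of_def mat_span_def by auto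
  have cf: "f \<in> carrier_mat n n" using fc by simp
  have cg: "g \<in> carrier_mat n n" using H unfolding idempotent_of_def mat_span_def by auto
  have ff: "f * f = f" using H unfolding idempotent_of_def by auto
  have "f * E i = f * f + f * g" using H cf cg by (simp add: mult_add_distrib_mat)
  also have "\<dots> = f" using ff H cf by simp
  finally have f: "f = c i \<cdot>\<^sub>m E i"
    using mat_lincomb_times_idempotent[OF car orth i] fc by simp
  have ci: "E i \<in> carrier_mat n n" using car i .
  have "f * f = (c i * c i) \<cdot>\<^sub>m E i"
    using ci orth i unfolding f
    by (simp add: mult_smult_distrib[of _ n n _ n] mult_smult_assoc_mat[of _ n n _ n])
      (auto intro: eq_matI)
  then have "(c i * c i) \<cdot>\<^sub>m E i = c i \<cdot>\<^sub>m E i" using ff f by metis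
  then have "c i * c i * E i $$ (x, y) = c i * E i $$ (x, y)" if "x < n" "y < n" for x y
    using ci that by (metis index_smult_mat(1) carrier_matD)
  then have "(c i * c i - c i) \<cdot>\<^sub>m E i = 0\<^sub>m n n"
    using ci by (intro eq_matI) (auto simp: left_diff_distrib)
  then have "c i * c i - c i = 0" using smult_mat_eq_0 ci nz i by blast
  then have "c i = 0 \<or> c i = 1" by auto
  then show "f = 0\<^sub>m n n \<or> g = 0\<^sub>m n n"
  proof
    assume "c i = 0" then show ?thesis using f ci by (intro disjI1 eq_matI) auto
  next
    assume "c i = 1"
    then have "E i = f" using f ci by (intro eq_matI) auto
    then have "f + g = f" using H by simp
    then have "g $$ (x, y) = 0" if "x < n" "y < n" for x y
      using cf cg that by (metis add_cancel_left_right index_add_mat(1) carrier_matD)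
    then have "g = 0\<^sub>m n n" using cg by (intro eq_matI) auto
    then show ?thesis ..
  qed
qed

lemma basis_of_orthogonal_idempotents:
  assumes car: "\<And>i. i \<le> d \<Longrightarrow> E i \<in> carrier_mat n n"
    and orth: "\<And>i j. i \<le> d \<Longrightarrow> j \<le> d \<Longrightarrow> E i * E j = (if i = j then E i else 0\<^sub>m n n)"
    and nz: "\<And>i. i \<le> d \<Longrightarrow> E i \<noteq> 0\<^sub>m n n"
  shows "basis_of n d (mat_span n d E) E"
  unfolding basis_of_def
proof (intro conjI allI impI)
  fix c i assume "mat_lincomb n d c E = 0\<^sub>m n n" "i \<le> d"
  then have "c i \<cdot>\<^sub>m E i = 0\<^sub>m n n"
    using mat_lincomb_times_idempotent[OF car orth \<open>i \<le> d\<close>, of c] car[of i] by simp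
  then show "c i = 0" using smult_mat_eq_0 car nz \<open>i \<le> d\<close> by blast
qed (use car in auto)

section \<open>Integrality of the intersection numbers\<close>

lemma zero_one_matrix_index:
  assumes "zero_one_matrix n M" "x < n" "y < n"
  shows "M $$ (x, y) \<in> {0, 1}"
proof -
  have "M $$ (x, y) \<in> elements_mat M"
    using assms by (auto simp: zero_one_matrix_def intro: elements_matI)
  then show ?thesis using assms(1) by (auto simp: zero_one_matrix_def)
qed

text \<open>Entries 0 and 1 with sum 1 have exactly one 1 among them. A position in the support of
  \<open>A h\<close> therefore isolates the coefficient of \<open>A h\<close> in any linear
  combination.\<close>

lemma zero_one_partition_witness:
  assumes zo: "\<And>i. i \<le> d \<Longrightarrow> zero_one_matrix n (A i)" and nz: "\<And>i. i \<le> d \<Longrightarrow> A i \<noteq> 0\<^sub>m n n"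
    and tot: "mat_lincomb n d (\<lambda>_. 1) A = all_ones n" and h: "h \<le> d"
  obtains x y where "x < n" "y < n" "\<And>i. i \<le> d \<Longrightarrow> A i $$ (x, y) = (if i = h then 1 else 0)"
proof -
  have car: "A i \<in> carrier_mat n n" if "i \<le> d" for i using zo[OF that] by (simp add: zero_one_matrix_def)
  have v: "A i $$ (x, y) \<in> {0, 1}" if "i \<le> d" "x < n" "y < n" for i x y
    using zero_one_matrix_index[OF zo] that by blast
  obtain x y where xy: "x < n" "y < n" "A h $$ (x, y) \<noteq> 0"
    using car[OF h] nz[OF h] by (metis carrier_matD eq_matI index_zero_mat)
  have one: "A h $$ (x, y) = 1" using v[OF h xy(1,2)] xy by auto
  have "(\<Sum>i\<le>d. A i $$ (x, y)) = 1"
    using arg_cong[OF tot, of "\<lambda>M. M $$ (x, y)"] xy by (simp add: all_ones_def)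
  then have "(\<Sum>i\<in>{..d} - {h}. A i $$ (x, y)) = 0"
    using one h by (simp add: sum.remove[of "{..d}" h])
  then have "\<forall>i\<in>{..d} - {h}. A i $$ (x, y) = 0"
    using v xy by (subst (asm) sum_nonneg_eq_0_iff) force+
  then show ?thesis using that xy one by auto
qed

text \<open>The eigenmatrices deliver the coefficients only as complex numbers. Evaluating the
  product at a witness for \<open>A h\<close> identifies such a coefficient with an integer matrix
  entry, so no closed formula for the intersection numbers has to be found.\<close>

lemma intersection_numbers_exist:
  fixes c :: "nat \<Rightarrow> nat \<Rightarrow> nat \<Rightarrow> complex"
  assumes zo: "\<And>i. i \<le> d \<Longrightarrow> zero_one_matrix n (A i)" and nz: "\<And>i. i \<le> d \<Longrightarrow> A i \<noteq> 0\<^sub>m n n"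
    and tot: "mat_lincomb n d (\<lambda>_. 1) A = all_ones n"
    and prod: "\<And>i j. i \<le> d \<Longrightarrow> j \<le> d \<Longrightarrow>
      complex_mat (A i) * complex_mat (A j) = mat_lincomb n d (c i j) (\<lambda>h. complex_mat (A h))"
  shows "\<exists>p :: nat \<Rightarrow> nat \<Rightarrow> nat \<Rightarrow> nat. \<forall>i\<le>d. \<forall>j\<le>d.
        A i * A j = mat_lincomb n d (\<lambda>h. int (p i j h)) A"
proof -
  have car: "A i \<in> carrier_mat n n" if "i \<le> d" for i using zo[OF that] by (simp add: zero_one_matrix_def)
  have v: "A i $$ (x, y) \<in> {0, 1}" if "i \<le> d" "x < n" "y < n" for i x y
    using zero_one_matrix_index[OF zo] that by blast
  have ent: "complex_of_int ((A i * A j) $$ (x, y)) = (\<Sum>h\<le>d. c i j h * of_int (A h $$ (x, y)))"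
    if "i \<le> d" "j \<le> d" "x < n" "y < n" for i j x y
  proof -
    have "complex_of_int ((A i * A j) $$ (x, y)) = complex_mat (A i * A j) $$ (x, y)"
      using car[OF that(1)] car[OF that(2)] that by auto
    also have "complex_mat (A i * A j) = complex_mat (A i) * complex_mat (A j)"
      using car[OF that(1)] car[OF that(2)] by (rule of_int_hom.mat_hom_mult)
    finally show ?thesis using prod[OF that(1,2)] that car
      by (auto intro!: sum.cong) (metis car carrier_matD index_map_mat(1))
  qed
  have nn: "0 \<le> (A i * A j) $$ (x, y)" if "i \<le> d" "j \<le> d" "x < n" "y < n" for i j x y
  proof -
    have "(A i * A j) $$ (x, y) = (\<Sum>z<n. A i $$ (x, z) * A j $$ (z, y))"
      using car[OF that(1)] car[OF that(2)] that by (auto simp: scalar_prod_def lessThan_atLeast0)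
    also have "\<dots> \<ge> 0" using v that by (intro sum_nonneg mult_nonneg_nonneg) force+
    finally show ?thesis .
  qed
  have "\<exists>p::nat. c i j h = of_nat p" if ij: "i \<le> d" "j \<le> d" and h: "h \<le> d" for i j h
  proof -
    obtain x y where xy: "x < n" "y < n" "\<And>i. i \<le> d \<Longrightarrow> A i $$ (x, y) = (if i = h then 1 else 0)"
      using zero_one_partition_witness[of d n A h, OF zo nz tot h] by blast
    have "(\<Sum>g\<le>d. c i j g * of_int (A g $$ (x, y))) = (\<Sum>g\<le>d. if g = h then c i j h else 0)"
      using xy by (intro sum.cong) auto
    then have "complex_of_int ((A i * A j) $$ (x, y)) = c i j h"
      using ent[OF ij xy(1,2)] h by simp
    then show ?thesis using nn[OF ij xy(1,2)]
      by (metis of_int_of_nat_eq zero_le_imp_eq_int)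
  qed
  then have "\<exists>p. \<forall>i j h. i \<le> d \<longrightarrow> j \<le> d \<longrightarrow> h \<le> d \<longrightarrow> c i j h = of_nat (p i j h)"
    by metis
  then obtain p :: "nat \<Rightarrow> nat \<Rightarrow> nat \<Rightarrow> nat"
    where p: "\<And>i j h. i \<le> d \<Longrightarrow> j \<le> d \<Longrightarrow> h \<le> d \<Longrightarrow> c i j h = of_nat (p i j h)" by blast
  have "A i * A j = mat_lincomb n d (\<lambda>h. int (p i j h)) A" if ij: "i \<le> d" "j \<le> d" for i j
  proof (rule eq_matI)
    fix x y assume "x < dim_row (mat_lincomb n d (\<lambda>h. int (p i j h)) A)"
      "y < dim_col (mat_lincomb n d (\<lambda>h. int (p i j h)) A)"
    then have xy: "x < n" "y < n" by auto
    have "complex_of_int ((A i * A j) $$ (x, y)) = of_int (\<Sum>h\<le>d. int (p i j h) * A h $$ (x, y))"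
      unfolding ent[OF ij xy] using p ij by simp
    then show "(A i * A j) $$ (x, y) = mat_lincomb n d (\<lambda>h. int (p i j h)) A $$ (x, y)"
      using xy by (simp only: of_int_eq_iff mat_lincomb_index)
  qed (use car ij in auto)
  then show ?thesis by blast
qed

section \<open>From a pair of eigenmatrices to a scheme\<close>

lemma times_mat_lincomb:
  assumes "\<And>i. i \<le> d \<Longrightarrow> E i \<in> carrier_mat n n" and M: "M \<in> carrier_mat n n"
  shows "M * mat_lincomb n d c E = mat_lincomb n d c (\<lambda>i. M * E i)"
proof (rule eq_matI)
  fix x y assume "x < dim_row (mat_lincomb n d c (\<lambda>i. M * E i))"
    "y < dim_col (mat_lincomb n d c (\<lambda>i. M * E i))"
  then have xy: "x < n" "y < n" by auto
  have "(M * mat_lincomb n d c E) $$ (x, y) = (\<Sum>z<n. M $$ (x, z) * (\<Sum>i\<le>d. c i * E i $$ (z, y)))"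
    using xy M by (auto simp: scalar_prod_def lessThan_atLeast0)
  also have "\<dots> = (\<Sum>i\<le>d. c i * (\<Sum>z<n. M $$ (x, z) * E i $$ (z, y)))"
    unfolding sum_distrib_left by (subst sum.swap) (simp add: mult.left_commute)
  also have "\<dots> = (\<Sum>i\<le>d. c i * (M * E i) $$ (x, y))"
    using xy M carrier_matD[OF assms(1)]
    by (intro sum.cong) (auto simp: scalar_prod_def lessThan_atLeast0)
  finally show "(M * mat_lincomb n d c E) $$ (x, y) = mat_lincomb n d c (\<lambda>i. M * E i) $$ (x, y)"
    using xy by simp
qed (use M in auto)

lemma smult_mat_lincomb: "a \<cdot>\<^sub>m mat_lincomb n d c M = mat_lincomb n d (\<lambda>i. a * c i) M"
  by (rule eq_matI) (auto simp: sum_distrib_left mult.assoc)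

lemma mat_lincomb_cong:
  assumes "\<And>i. i \<le> d \<Longrightarrow> c i = c' i" "\<And>i. i \<le> d \<Longrightarrow> M i = M' i"
  shows "mat_lincomb n d c M = mat_lincomb n d c' M'"
  by (rule eq_matI) (use assms in \<open>auto intro!: sum.cong\<close>)

lemma mat_lincomb_smult:
  assumes "\<And>i. i \<le> d \<Longrightarrow> M i \<in> carrier_mat n n"
  shows "mat_lincomb n d c (\<lambda>i. a i \<cdot>\<^sub>m M i) = mat_lincomb n d (\<lambda>i. c i * a i) M"
  by (rule eq_matI) (use carrier_matD[OF assms] in \<open>auto intro!: sum.cong\<close>)

text \<open>P and Q show that the \<open>A i\<close> and the \<open>E i\<close> have the same span.
  Orthogonality gives A_i A_j as the sum of the P_hi P_hj E_h, and Q expands this back into the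
  \<open>A h\<close>. Orthogonality alone would allow \<open>E j\<close> to vanish; a nonzero entry
  in each column of Q excludes that.\<close>

lemma association_scheme_of_eigenmatrices:
  assumes zo: "\<And>i. i \<le> d \<Longrightarrow> zero_one_matrix n (A i)" and nz: "\<And>i. i \<le> d \<Longrightarrow> A i \<noteq> 0\<^sub>m n n"
    and A0: "A 0 = 1\<^sub>m n"
    and tot: "mat_lincomb n d (\<lambda>_. 1) A = all_ones n"
    and sym: "\<And>i. i \<le> d \<Longrightarrow> transpose_mat (A i) = A i"
    and P: "first_eigenmatrix n d A E P" and Q: "second_eigenmatrix n d A E Q"
    and orth: "\<And>i j. i \<le> d \<Longrightarrow> j \<le> d \<Longrightarrow> E i * E j = (if i = j then E i else 0\<^sub>m n n)"
    and E0: "E 0 = (1 / of_nat n) \<cdot>\<^sub>m all_ones n"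
    and Qnz: "\<And>j. j \<le> d \<Longrightarrow> \<exists>i\<le>d. Q $$ (i, j) \<noteq> 0"
  shows "symmetric_association_scheme n d A \<and> primitive_idempotent_basis n d A E"
proof -
  define cA where "cA = (\<lambda>i. complex_mat (A i))"
  have carA: "A i \<in> carrier_mat n n" if "i \<le> d" for i using zo[OF that] by (simp add: zero_one_matrix_def)
  have car: "cA i \<in> carrier_mat n n" if "i \<le> d" for i using carA[OF that] by (simp add: cA_def)
  have EQ: "E j = mat_lincomb n d (\<lambda>i. 1 / of_nat n * Q $$ (i, j)) cA" if "j \<le> d" for j
    using Q that unfolding second_eigenmatrix_def cA_def by (simp add: smult_mat_lincomb)
  have AP: "cA j = mat_lincomb n d (\<lambda>i. P $$ (i, j)) E" if "j \<le> d" for j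
    using P that unfolding first_eigenmatrix_def cA_def by simp
  have carE: "E j \<in> carrier_mat n n" if "j \<le> d" for j using EQ[OF that] by simp
  have span: "mat_span n d E = bose_mesner n d A"
    unfolding bose_mesner_def cA_def[symmetric] by (rule mat_span_eqI) (rule EQ AP; assumption)+
  have Enz: "E j \<noteq> 0\<^sub>m n n" if j: "j \<le> d" for j
  proof
    assume E: "E j = 0\<^sub>m n n"
    obtain h where h: "h \<le> d" "Q $$ (h, j) \<noteq> 0" using Qnz[OF j] by blast
    obtain x y where xy: "x < n" "y < n" "\<And>i. i \<le> d \<Longrightarrow> A i $$ (x, y) = (if i = h then 1 else 0)"
      using zero_one_partition_witness[of d n A h, OF zo nz tot h(1)] by blast
    have "E j $$ (x, y) = (\<Sum>i\<le>d. 1 / of_nat n * Q $$ (i, j) * cA i $$ (x, y))"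
      using xy unfolding EQ[OF j] by simp
    also have "\<dots> = (\<Sum>i\<le>d. if i = h then 1 / of_nat n * Q $$ (h, j) else 0)"
      using xy carrier_matD[OF carA] by (intro sum.cong refl) (auto simp: cA_def)
    finally have "E j $$ (x, y) = \<dots>" .
    \<comment> \<open>The bound \<open>x < n\<close> also gives \<open>n > 0\<close>, so the factor
      1/n is nonzero.\<close>
    then show False using E xy h by auto
  qed
  have prod: "cA i * cA j =
      mat_lincomb n d (\<lambda>g. \<Sum>h\<le>d. P $$ (h, j) * P $$ (h, i) * (1 / of_nat n * Q $$ (g, h))) cA"
    if ij: "i \<le> d" "j \<le> d" for i j
  proof -
    have "cA i * cA j = mat_lincomb n d (\<lambda>h. P $$ (h, j)) (\<lambda>h. cA i * E h)"
      unfolding AP[OF ij(2)] by (rule times_mat_lincomb) (use carE car[OF ij(1)] in auto)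
    also have "\<dots> = mat_lincomb n d (\<lambda>h. P $$ (h, j)) (\<lambda>h. P $$ (h, i) \<cdot>\<^sub>m E h)"
      unfolding AP[OF ij(1)]
      by (rule mat_lincomb_cong) (simp_all add: mat_lincomb_times_idempotent[OF carE orth])
    also have "\<dots> = mat_lincomb n d (\<lambda>h. P $$ (h, j) * P $$ (h, i)) E"
      by (rule mat_lincomb_smult) (rule carE)
    also have "\<dots> = mat_lincomb n d (\<lambda>g. \<Sum>h\<le>d. P $$ (h, j) * P $$ (h, i) * (1 / of_nat n * Q $$ (g, h))) cA"
      by (rule mat_lincomb_mat_lincomb) (rule EQ)
    finally show ?thesis .
  qed
  have "\<exists>p :: nat \<Rightarrow> nat \<Rightarrow> nat \<Rightarrow> nat. \<forall>i\<le>d. \<forall>j\<le>d. A i * A j = mat_lincomb n d (\<lambda>h. int (p i j h)) A"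
    by (rule intersection_numbers_exist[OF zo nz tot]) (use prod in \<open>simp_all add: cA_def\<close>)
  then have "symmetric_association_scheme n d A"
    unfolding symmetric_association_scheme_def using zo nz A0 tot sym by blast
  moreover have "primitive_idempotent_basis n d A E"
    unfolding primitive_idempotent_basis_def span[symmetric]
    using E0 primitive_idempotent_orthogonal_basis[OF carE orth Enz]
      basis_of_orthogonal_idempotents[OF carE orth Enz] by blast
  ultimately show ?thesis ..
qed

lemma map_mat_of_real_lincomb:
  assumes "\<And>i. i \<le> d \<Longrightarrow> M i \<in> carrier_mat n n"
  shows "map_mat complex_of_real (mat_lincomb n d c M)
    = mat_lincomb n d (\<lambda>i. complex_of_real (c i)) (\<lambda>i. map_mat complex_of_real (M i))"
  by (rule eq_matI) (use carrier_matD[OF assms] in \<open>auto intro!: sum.cong\<close>)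

section \<open>Matrices in blocks\<close>

lemma div_mod_block [simp]:
  assumes "(x::nat) < v"
  shows "(a * v + x) div v = a" "(a * v + x) mod v = x"
  using assms by auto

lemma block_index_cases:
  assumes "(i::nat) < c * v"
  obtains a x where "i = a * v + x" "a < c" "x < v"
proof
  have "0 < v" using assms by (cases v) auto
  then show "i mod v < v" by simp
  show "i = (i div v) * v + i mod v" by simp
  show "i div v < c" using assms by (simp add: less_mult_imp_div_less)
qed

lemma block_index_less:
  assumes "(a::nat) < c" "x < v"
  shows "a * v + x < c * v"
proof -
  have "a * v + x < Suc a * v" using assms by simp
  also have "\<dots> \<le> c * v" using assms by (intro mult_le_mono1) simp
  finally show ?thesis .
qed

lemma sum_blocks:
  fixes g :: "nat \<Rightarrow> 'a::comm_monoid_add"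
  shows "(\<Sum>i<c * v. g i) = (\<Sum>a<c. \<Sum>x<v. g (a * v + x))"
proof -
  have "(\<Sum>i<c * v. g i) = (\<Sum>a<c. sum g {a * v..<a * v + v})"
    by (simp add: sum.nat_group)
  also have "\<dots> = (\<Sum>a<c. \<Sum>x<v. g (a * v + x))"
  proof (rule sum.cong)
    fix a
    show "sum g {a * v..<a * v + v} = (\<Sum>x<v. g (a * v + x))"
      using sum.shift_bounds_nat_ivl[of g 0 "a * v" v]
      by (simp add: atLeast0LessThan add.commute)
  qed simp
  finally show ?thesis .
qed

lemma less_4_cases: "(a::nat) < 4 \<Longrightarrow> a = 0 \<or> a = 1 \<or> a = 2 \<or> a = 3" by auto

lemma sum_lessThan_4: "(\<Sum>i<4. f i) = f 0 + f 1 + f 2 + f (3::nat)"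
  by (simp add: eval_nat_numeral)

text \<open>A row of a matrix of order 4v is a pair of a block number a < 4 and x < v; a div 2 selects the half
  and a mod 2 the coordinate on which \<open>swap2\<close> acts.\<close>

definition block4 :: "nat \<Rightarrow> (nat \<Rightarrow> nat \<Rightarrow> nat \<Rightarrow> nat \<Rightarrow> 'a) \<Rightarrow> 'a mat" where
  "block4 v f = mat (4 * v) (4 * v) (\<lambda>(i, j). f (i div v) (j div v) (i mod v) (j mod v))"

lemma block4_carrier [simp]: "block4 v f \<in> carrier_mat (4 * v) (4 * v)"
  by (simp add: block4_def)

lemma block4_dim [simp]: "dim_row (block4 v f) = 4 * v" "dim_col (block4 v f) = 4 * v"
  by (simp_all add: block4_def)

lemma block4_index:
  assumes "a < 4" "b < 4" "x < v" "y < v"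
  shows "block4 v f $$ (a * v + x, b * v + y) = f a b x y"
  using assms block_index_less[of a 4 x v] block_index_less[of b 4 y v] by (simp add: block4_def)

lemma eq_block4I:
  assumes "M \<in> carrier_mat (4 * v) (4 * v)"
    and "\<And>a b x y. a < 4 \<Longrightarrow> b < 4 \<Longrightarrow> x < v \<Longrightarrow> y < v \<Longrightarrow> M $$ (a * v + x, b * v + y) = f a b x y"
  shows "M = block4 v f"
proof (rule eq_matI)
  fix i j assume "i < dim_row (block4 v f)" "j < dim_col (block4 v f)"
  then have "i < 4 * v" "j < 4 * v" by auto
  then obtain a x b y where "i = a * v + x" "a < 4" "x < v" "j = b * v + y" "b < 4" "y < v"
    by (meson block_index_cases)
  then show "M $$ (i, j) = block4 v f $$ (i, j)" using assms(2) by (simp add: block4_index)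
qed (use assms in auto)

lemma block4_cong:
  assumes "\<And>a b x y. a < 4 \<Longrightarrow> b < 4 \<Longrightarrow> x < v \<Longrightarrow> y < v \<Longrightarrow> f a b x y = g a b x y"
  shows "block4 v f = block4 v g"
  by (rule eq_block4I) (auto simp: block4_index assms)

text \<open>The sum over the four blocks is kept inside the sum over \<open>z\<close>, so that for
  fixed \<open>z\<close> it can be written out as four explicit terms.\<close>

lemma block4_mult:
  fixes f g :: "nat \<Rightarrow> nat \<Rightarrow> nat \<Rightarrow> nat \<Rightarrow> 'a::comm_semiring_0"
  shows "block4 v f * block4 v g = block4 v (\<lambda>a b x y. \<Sum>z<v. \<Sum>c<4. f a c x z * g c b z y)"
proof (rule eq_block4I)
  fix a b x y :: nat assume H: "a < 4" "b < 4" "x < v" "y < v"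
  have "(block4 v f * block4 v g) $$ (a * v + x, b * v + y)
    = (\<Sum>i<4 * v. block4 v f $$ (a * v + x, i) * block4 v g $$ (i, b * v + y))"
    using H block_index_less[of a 4 x v] block_index_less[of b 4 y v]
    by (simp add: scalar_prod_def lessThan_atLeast0)
  also have "\<dots> = (\<Sum>c<4. \<Sum>z<v. f a c x z * g c b z y)"
    unfolding sum_blocks using H by (intro sum.cong refl) (simp add: block4_index)
  also have "\<dots> = (\<Sum>z<v. \<Sum>c<4. f a c x z * g c b z y)" by (rule sum.swap)
  finally show "(block4 v f * block4 v g) $$ (a * v + x, b * v + y) = \<dots>" .
qed (rule mult_carrier_mat[OF block4_carrier block4_carrier])

lemma block4_lincomb:
  "mat_lincomb (4 * v) d c (\<lambda>h. block4 v (f h)) = block4 v (\<lambda>a b x y. \<Sum>h\<le>d. c h * f h a b x y)"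
  by (rule eq_block4I) (auto simp: block4_index block_index_less)

lemma block4_transpose: "transpose_mat (block4 v f) = block4 v (\<lambda>a b x y. f b a y x)"
  by (rule eq_block4I) (auto simp: block4_index block_index_less)

lemma block4_map: "map_mat g (block4 v f) = block4 v (\<lambda>a b x y. g (f a b x y))"
  by (rule eq_block4I) (auto simp: block4_index block_index_less)

section \<open>Kronecker products and the eight matrices entry by entry\<close>

lemma kronecker_carrier:
  "M \<in> carrier_mat p p \<Longrightarrow> N \<in> carrier_mat q q \<Longrightarrow> kronecker M N \<in> carrier_mat (p * q) (p * q)"
  by (simp add: kronecker_def)

lemma kronecker_index:
  assumes "M \<in> carrier_mat p p" "N \<in> carrier_mat q q" "a < p" "b < p" "x < q" "y < q"
  shows "kronecker M N $$ (a * q + x, b * q + y) = M $$ (a, b) * N $$ (x, y)"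
  using assms block_index_less[of a p x q] block_index_less[of b p y q]
  by (simp add: kronecker_def)

lemma four_block_eq_block4:
  assumes car: "B11 \<in> carrier_mat (2 * v) (2 * v)" "B12 \<in> carrier_mat (2 * v) (2 * v)"
      "B21 \<in> carrier_mat (2 * v) (2 * v)" "B22 \<in> carrier_mat (2 * v) (2 * v)"
    and B: "\<And>a b x y. a < 2 \<Longrightarrow> b < 2 \<Longrightarrow> x < v \<Longrightarrow> y < v \<Longrightarrow> B11 $$ (a * v + x, b * v + y) = f a b x y"
      "\<And>a b x y. a < 2 \<Longrightarrow> b < 2 \<Longrightarrow> x < v \<Longrightarrow> y < v \<Longrightarrow> B12 $$ (a * v + x, b * v + y) = f a (b + 2) x y"
      "\<And>a b x y. a < 2 \<Longrightarrow> b < 2 \<Longrightarrow> x < v \<Longrightarrow> y < v \<Longrightarrow> B21 $$ (a * v + x, b * v + y) = f (a + 2) b x y"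
      "\<And>a b x y. a < 2 \<Longrightarrow> b < 2 \<Longrightarrow> x < v \<Longrightarrow> y < v \<Longrightarrow> B22 $$ (a * v + x, b * v + y) = f (a + 2) (b + 2) x y"
  shows "four_block_mat B11 B12 B21 B22 = block4 v f"
proof (rule eq_block4I)
  fix a b x y :: nat assume H: "a < 4" "b < 4" "x < v" "y < v"
  have lo: "a * v + x < 2 * v \<longleftrightarrow> a < 2" if "x < v" for a x :: nat
  proof
    show "a * v + x < 2 * v \<Longrightarrow> a < 2"
      by (metis add_lessD1 mult_less_cancel2)
  qed (use that block_index_less in blast)
  \<comment> \<open>Subtraction on naturals truncates, so the shift into the second half is sound
    only for block numbers 2 and 3.\<close>
  have hi: "a * v + x - 2 * v = (a - 2) * v + x" if "\<not> a < 2" for a x :: nat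
  proof -
    have "a - 2 + 2 = a" using that by simp
    then have "a * v = (a - 2) * v + 2 * v" by (metis add_mult_distrib)
    then show ?thesis by simp
  qed
  have ab: "a - 2 < 2" "b - 2 < 2" using H by auto
  have [simp]: "Suc (Suc (n - 2)) = n" if "2 \<le> n" for n using that by simp
  have "four_block_mat B11 B12 B21 B22 $$ (a * v + x, b * v + y) =
    (if a < 2 then if b < 2 then B11 $$ (a * v + x, b * v + y) else B12 $$ (a * v + x, (b - 2) * v + y)
     else if b < 2 then B21 $$ ((a - 2) * v + x, b * v + y) else B22 $$ ((a - 2) * v + x, (b - 2) * v + y))"
    using H block_index_less[of a 4 x v] block_index_less[of b 4 y v] lo[of x a] lo[of y b] hi
    by (subst index_mat_four_block) (auto simp: car[THEN carrier_matD(1)] car[THEN carrier_matD(2)])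
  also have "\<dots> = f a b x y"
    using H ab B(1)[of a b x y] B(2)[of a "b - 2" x y] B(3)[of "a - 2" b x y] B(4)[of "a - 2" "b - 2" x y]
    by (auto simp: not_less)
  finally show "four_block_mat B11 B12 B21 B22 $$ (a * v + x, b * v + y) = f a b x y" .
next
  have "four_block_mat B11 B12 B21 B22 \<in> carrier_mat (2 * v + 2 * v) (2 * v + 2 * v)"
    using car by (intro four_block_carrier_mat)
  then show "four_block_mat B11 B12 B21 B22 \<in> carrier_mat (4 * v) (4 * v)" by simp
qed

text \<open>Here \<open>tr\<close> reads its argument transposed when the row block lies in the
  lower half; this is where the blocks W_1^T and W_2^T of A_5 and A_6 come from.\<close>

definition scheme_kernel :: "int mat \<Rightarrow> int mat \<Rightarrow> int mat \<Rightarrow> nat \<Rightarrow> nat \<Rightarrow> nat \<Rightarrow> nat \<Rightarrow> nat \<Rightarrow> int" where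
  "scheme_kernel A W1 W2 h a b x y =
    (let i = (if x = y then 1 else 0); same = (a div 2 = b div 2); eq = (a mod 2 = b mod 2);
         tr = (\<lambda>M. if a < 2 then M $$ (x, y) else M $$ (y, x)) in
     [ if same \<and> eq then i else 0,
       if same \<and> \<not> eq then i else 0,
       if same then A $$ (x, y) else 0,
       if same then 1 - i - A $$ (x, y) else 0,
       if same then 0 else i,
       if same then 0 else if eq then tr W1 else tr W2,
       if same then 0 else if eq then tr W2 else tr W1,
       if same then 0 else 1 - i - A $$ (x, y)] ! h)"

lemma le_7_cases: "(h::nat) \<le> 7 \<Longrightarrow> h = 0 \<or> h = 1 \<or> h = 2 \<or> h = 3 \<or> h = 4 \<or> h = 5 \<or> h = 6 \<or> h = 7"
  by auto

lemma swap2_carrier [simp]: "swap2 \<in> carrier_mat 2 2"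
  by (rule carrier_matI) (simp_all add: swap2_def mat_of_rows_list_def)

lemma swap2_index [simp]:
  "a < 2 \<Longrightarrow> b < 2 \<Longrightarrow> (swap2 :: int mat) $$ (a, b) = (if a = b then 0 else 1)"
  by (auto simp: swap2_def mat_of_rows_list_def less_2_cases_iff)

lemma all_ones_carrier [simp]: "all_ones n \<in> carrier_mat n n"
  by (simp add: all_ones_def)

lemma all_ones_index [simp]: "x < n \<Longrightarrow> y < n \<Longrightarrow> all_ones n $$ (x, y) = 1"
  by (simp add: all_ones_def)

lemma scheme_matrices_eq_block4:
  assumes car: "A \<in> carrier_mat v v" "W1 \<in> carrier_mat v v" "W2 \<in> carrier_mat v v" and h: "h \<le> 7"
  shows "scheme_matrices v A W1 W2 h = block4 v (scheme_kernel A W1 W2 h)"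
proof -
  have C: "all_ones v - 1\<^sub>m v - A \<in> carrier_mat v v" by (rule minus_carrier_mat[OF car(1)])
  note [simp] = car C
  have [simp]: "transpose_mat W1 \<in> carrier_mat v v" "transpose_mat W2 \<in> carrier_mat v v" by auto
  note [simp] = kronecker_carrier[of _ 2 _ v] kronecker_index[of _ 2 _ v] block_index_less
    carrier_matD[OF kronecker_carrier[of _ 2 _ v]]
    carrier_matD[OF car(1)] carrier_matD[OF car(2)] carrier_matD[OF car(3)]
    carrier_matD[OF C]
  \<comment> \<open>Selecting from the list before any other rewriting leaves one four-block matrix
    in each of the eight cases.\<close>
  have nth8: "[m0, m1, m2, m3, m4, m5, m6, m7] ! 0 = m0" "[m0, m1, m2, m3, m4, m5, m6, m7] ! 1 = m1"
    "[m0, m1, m2, m3, m4, m5, m6, m7] ! 2 = m2" "[m0, m1, m2, m3, m4, m5, m6, m7] ! 3 = m3"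
    "[m0, m1, m2, m3, m4, m5, m6, m7] ! 4 = m4" "[m0, m1, m2, m3, m4, m5, m6, m7] ! 5 = m5"
    "[m0, m1, m2, m3, m4, m5, m6, m7] ! 6 = m6" "[m0, m1, m2, m3, m4, m5, m6, m7] ! 7 = m7"
    for m0 m1 m2 m3 m4 m5 m6 m7 :: 'b by simp_all
  show ?thesis
    using le_7_cases[OF h]
    apply (elim disjE)
    apply (simp_all only: scheme_matrices_def Let_def nth8)
    apply (rule four_block_eq_block4; auto simp: scheme_kernel_def Let_def)+
    done
qed

lemma block4_neq_0:
  assumes "a < 4" "b < 4" "x < v" "y < v" "f a b x y \<noteq> (0 :: 'a::zero)"
  shows "block4 v f \<noteq> 0\<^sub>m (4 * v) (4 * v)"
proof
  assume "block4 v f = 0\<^sub>m (4 * v) (4 * v)"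
  then have "block4 v f $$ (a * v + x, b * v + y) = 0"
    using block_index_less[of a 4 x v] block_index_less[of b 4 y v] assms by simp
  then show False using assms by (simp add: block4_index)
qed

lemma zero_one_matrix_block4:
  assumes "\<And>a b x y. a < 4 \<Longrightarrow> b < 4 \<Longrightarrow> x < v \<Longrightarrow> y < v \<Longrightarrow> f a b x y \<in> {0, 1}"
  shows "zero_one_matrix (4 * v) (block4 v f)"
  unfolding zero_one_matrix_def
proof (intro conjI subsetI)
  fix e assume "e \<in> elements_mat (block4 v f)"
  then obtain i j where ij: "i < 4 * v" "j < 4 * v" "e = block4 v f $$ (i, j)"
    by (auto simp: elements_mat_def)
  obtain a x b y where "i = a * v + x" "a < 4" "x < v" "j = b * v + y" "b < 4" "y < v"
    using ij(1,2) by (meson block_index_cases)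
  then show "e \<in> {0, 1}" using assms ij(3) by (simp add: block4_index)
qed simp

lemma all_ones_eq_block4: "all_ones (4 * v) = block4 v (\<lambda>a b x y. 1)"
  by (rule eq_block4I) (simp_all add: block_index_less)

lemma one_mat_eq_block4: "1\<^sub>m (4 * v) = block4 v (\<lambda>a b x y. of_bool (a = b \<and> x = y))"
proof (rule eq_block4I)
  fix a b x y :: nat assume H: "a < 4" "b < 4" "x < v" "y < v"
  have "a * v + x = b * v + y \<longleftrightarrow> a = b \<and> x = y"
    using H(3,4) by (metis div_mod_block)
  then show "1\<^sub>m (4 * v) $$ (a * v + x, b * v + y) = of_bool (a = b \<and> x = y)"
    using H by (simp add: block_index_less)
qed simp

lemma scheme_kernel_simps:
  "scheme_kernel A W1 W2 0 a b x y = of_bool (a div 2 = b div 2 \<and> a mod 2 = b mod 2 \<and> x = y)"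
  "scheme_kernel A W1 W2 1 a b x y = of_bool (a div 2 = b div 2 \<and> a mod 2 \<noteq> b mod 2 \<and> x = y)"
  "scheme_kernel A W1 W2 2 a b x y = (if a div 2 = b div 2 then A $$ (x, y) else 0)"
  "scheme_kernel A W1 W2 3 a b x y = (if a div 2 = b div 2 then 1 - of_bool (x = y) - A $$ (x, y) else 0)"
  "scheme_kernel A W1 W2 4 a b x y = of_bool (a div 2 \<noteq> b div 2 \<and> x = y)"
  "scheme_kernel A W1 W2 5 a b x y = (if a div 2 = b div 2 then 0 else
      if (a mod 2 = b mod 2) then (if a < 2 then W1 $$ (x, y) else W1 $$ (y, x))
      else (if a < 2 then W2 $$ (x, y) else W2 $$ (y, x)))"
  "scheme_kernel A W1 W2 6 a b x y = (if a div 2 = b div 2 then 0 else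
      if (a mod 2 = b mod 2) then (if a < 2 then W2 $$ (x, y) else W2 $$ (y, x))
      else (if a < 2 then W1 $$ (x, y) else W1 $$ (y, x)))"
  "scheme_kernel A W1 W2 7 a b x y = (if a div 2 = b div 2 then 0 else 1 - of_bool (x = y) - A $$ (x, y))"
  by (auto simp: scheme_kernel_def Let_def)

section \<open>The algebra spanned by the scheme\<close>

lemma sum_atMost_7: "(\<Sum>i\<le>7. f i) = f 0 + f 1 + f 2 + f 3 + f 4 + f 5 + f 6 + f (7::nat)"
  by (simp add: eval_nat_numeral)

lemma all_le_7:
  "(\<forall>i\<le>7. P i) \<longleftrightarrow> P 0 \<and> P 1 \<and> P 2 \<and> P 3 \<and> P 4 \<and> P 5 \<and> P 6 \<and> P (7::nat)"
proof -
  have "{..7::nat} = {0,1,2,3,4,5,6,7}" by auto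
  then have "(\<forall>i\<in>{..7}. P i) \<longleftrightarrow> P 0 \<and> P 1 \<and> P 2 \<and> P 3 \<and> P 4 \<and> P 5 \<and> P 6 \<and> P (7::nat)"
    by (simp only:) blast
  then show ?thesis by auto
qed

text \<open>In matrix terms \<open>adj_sq\<close> says (A - sI)(A - tI) = (k + st) J, and applying
  it to the all-ones vector gives \<open>mu_v\<close>. Orthogonality of both rows and columns is
  needed since D^2 contains W W^T in the upper half and W^T W in the lower. The same
  \<open>k\<close> is valency and weight.\<close>

locale srg_weighing_kernel =
  fixes v :: nat and adj wgh :: "nat \<Rightarrow> nat \<Rightarrow> real" and k s t :: real
  assumes adj_row: "x < v \<Longrightarrow> (\<Sum>z<v. adj x z) = k"
    and adj_col: "y < v \<Longrightarrow> (\<Sum>z<v. adj z y) = k"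
    and adj_sq: "x < v \<Longrightarrow> y < v \<Longrightarrow>
      (\<Sum>z<v. adj x z * adj z y) = - (s * t) * of_bool (x = y) + (s + t) * adj x y + (k + s * t)"
    and wgh_rows: "x < v \<Longrightarrow> y < v \<Longrightarrow> (\<Sum>z<v. wgh x z * wgh y z) = k * of_bool (x = y)"
    and wgh_cols: "x < v \<Longrightarrow> y < v \<Longrightarrow> (\<Sum>z<v. wgh z x * wgh z y) = k * of_bool (x = y)"
    and mu_v: "(k + s * t) * real v = (k - s) * (k - t)"
    and pos: "0 < k" "s < k" "t < s" "0 < v"
begin

definition srg_kernel :: "real \<Rightarrow> real \<Rightarrow> real \<Rightarrow> nat \<Rightarrow> nat \<Rightarrow> real" where
  "srg_kernel a b c x y = a * of_bool (x = y) + b * adj x y + c"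

text \<open>The multiplication table of the span of I, A and J: AJ = JA = kJ, J^2 = vJ, and A^2 from
  \<open>adj_sq\<close>. The terms containing a Kronecker delta in \<open>z\<close> are grouped
  apart so that their sums collapse.\<close>

lemma srg_kernel_mult:
  assumes "x < v" "y < v"
  shows "(\<Sum>z<v. srg_kernel a b c x z * srg_kernel a' b' c' z y) =
    srg_kernel (a * a' - s * t * (b * b')) (a * b' + b * a' + (s + t) * (b * b'))
      (a * c' + c * a' + k * (b * c' + c * b') + (k + s * t) * (b * b') + real v * (c * c')) x y"
proof -
  have pt: "srg_kernel a b c x z * srg_kernel a' b' c' z y =
     of_bool (x = z) * (a * a' * of_bool (z = y) + a * b' * adj z y + a * c')
     + of_bool (z = y) * (b * a' * adj x z + c * a')
     + b * b' * (adj x z * adj z y) + b * c' * adj x z + c * b' * adj z y + c * c'" for z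
    by (simp add: srg_kernel_def algebra_simps)
  have "(\<Sum>z<v. srg_kernel a b c x z * srg_kernel a' b' c' z y) =
     (\<Sum>z<v. of_bool (x = z) * (a * a' * of_bool (z = y) + a * b' * adj z y + a * c'))
     + (\<Sum>z<v. of_bool (z = y) * (b * a' * adj x z + c * a'))
     + b * b' * (\<Sum>z<v. adj x z * adj z y) + b * c' * (\<Sum>z<v. adj x z) + c * b' * (\<Sum>z<v. adj z y)
     + real v * (c * c')"
    unfolding pt by (simp only: sum.distrib sum_distrib_left[symmetric]) simp
  also have "(\<Sum>z<v. of_bool (x = z) * (a * a' * of_bool (z = y) + a * b' * adj z y + a * c'))
    = a * a' * of_bool (x = y) + a * b' * adj x y + a * c'"
    using assms by (simp add: of_bool_def if_distrib[of "\<lambda>q. q * _"] cong: if_cong)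
  also have "(\<Sum>z<v. of_bool (z = y) * (b * a' * adj x z + c * a')) = b * a' * adj x y + c * a'"
    using assms by (simp add: of_bool_def if_distrib[of "\<lambda>q. q * _"] cong: if_cong)
  finally show ?thesis
    unfolding adj_sq[OF assms] adj_row[OF assms(1)] adj_col[OF assms(2)] srg_kernel_def
    by (simp add: algebra_simps)
qed

definition parity_sign :: "nat \<Rightarrow> nat \<Rightarrow> real" where
  "parity_sign a b = (if a mod 2 = b mod 2 then 1 else - 1)"

definition wgh_half :: "nat \<Rightarrow> nat \<Rightarrow> nat \<Rightarrow> real" where
  "wgh_half a x y = (if a < 2 then wgh x y else wgh y x)"

text \<open>The coefficients 0, 1, 2 (on the diagonal halves) and 3, 4, 5 (off them) belong to I, A, J, each
  tensored with the all-ones matrix of order 2; coefficients 6 and 7 belong to the blocks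
  \<open>(1 - swap2)\<close> tensored with I and with W, that is, to \<open>A 0 - A 1\<close> and \<open>A 5 - A 6\<close>.\<close>

definition algebra_kernel :: "(nat \<Rightarrow> real) \<Rightarrow> nat \<Rightarrow> nat \<Rightarrow> nat \<Rightarrow> nat \<Rightarrow> real" where
  "algebra_kernel q a b x y =
    (if a div 2 = b div 2 then srg_kernel (q 0) (q 1) (q 2) x y + parity_sign a b * q 6 * of_bool (x = y)
     else srg_kernel (q 3) (q 4) (q 5) x y + parity_sign a b * q 7 * wgh_half a x y)"

text \<open>The structure constants in the coordinates of \<open>algebra_kernel\<close>. Each factor
  2 comes from J_2^2 = 2 J_2 or from (I_2 - Pi)^2 = 2 (I_2 - Pi). Coordinates 0 to 5 never mix with
  6 and 7, because J_2 (I_2 - Pi) = 0.\<close>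

definition coeff_mult :: "(nat \<Rightarrow> real) \<Rightarrow> (nat \<Rightarrow> real) \<Rightarrow> nat \<Rightarrow> real" where
  "coeff_mult p q = (!)
    [2 * (p 0 * q 0 - s * t * (p 1 * q 1)) + 2 * (p 3 * q 3 - s * t * (p 4 * q 4)),
     2 * (p 0 * q 1 + p 1 * q 0 + (s + t) * (p 1 * q 1)) + 2 * (p 3 * q 4 + p 4 * q 3 + (s + t) * (p 4 * q 4)),
     2 * (p 0 * q 2 + p 2 * q 0 + k * (p 1 * q 2 + p 2 * q 1) + (k + s * t) * (p 1 * q 1) + real v * (p 2 * q 2))
     + 2 * (p 3 * q 5 + p 5 * q 3 + k * (p 4 * q 5 + p 5 * q 4) + (k + s * t) * (p 4 * q 4) + real v * (p 5 * q 5)),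
     2 * (p 0 * q 3 - s * t * (p 1 * q 4)) + 2 * (p 3 * q 0 - s * t * (p 4 * q 1)),
     2 * (p 0 * q 4 + p 1 * q 3 + (s + t) * (p 1 * q 4)) + 2 * (p 3 * q 1 + p 4 * q 0 + (s + t) * (p 4 * q 1)),
     2 * (p 0 * q 5 + p 2 * q 3 + k * (p 1 * q 5 + p 2 * q 4) + (k + s * t) * (p 1 * q 4) + real v * (p 2 * q 5))
     + 2 * (p 3 * q 2 + p 5 * q 0 + k * (p 4 * q 2 + p 5 * q 1) + (k + s * t) * (p 4 * q 1) + real v * (p 5 * q 2)),
     2 * p 6 * q 6 + 2 * k * p 7 * q 7,
     2 * p 6 * q 7 + 2 * p 7 * q 6]"

lemma coeff_mult_simps:
  "coeff_mult p q 0 = 2 * (p 0 * q 0 - s * t * (p 1 * q 1)) + 2 * (p 3 * q 3 - s * t * (p 4 * q 4))"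
  "coeff_mult p q 1 = 2 * (p 0 * q 1 + p 1 * q 0 + (s + t) * (p 1 * q 1)) + 2 * (p 3 * q 4 + p 4 * q 3 + (s + t) * (p 4 * q 4))"
  "coeff_mult p q 2 = 2 * (p 0 * q 2 + p 2 * q 0 + k * (p 1 * q 2 + p 2 * q 1) + (k + s * t) * (p 1 * q 1) + real v * (p 2 * q 2))
     + 2 * (p 3 * q 5 + p 5 * q 3 + k * (p 4 * q 5 + p 5 * q 4) + (k + s * t) * (p 4 * q 4) + real v * (p 5 * q 5))"
  "coeff_mult p q 3 = 2 * (p 0 * q 3 - s * t * (p 1 * q 4)) + 2 * (p 3 * q 0 - s * t * (p 4 * q 1))"
  "coeff_mult p q 4 = 2 * (p 0 * q 4 + p 1 * q 3 + (s + t) * (p 1 * q 4)) + 2 * (p 3 * q 1 + p 4 * q 0 + (s + t) * (p 4 * q 1))"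
  "coeff_mult p q 5 = 2 * (p 0 * q 5 + p 2 * q 3 + k * (p 1 * q 5 + p 2 * q 4) + (k + s * t) * (p 1 * q 4) + real v * (p 2 * q 5))
     + 2 * (p 3 * q 2 + p 5 * q 0 + k * (p 4 * q 2 + p 5 * q 1) + (k + s * t) * (p 4 * q 1) + real v * (p 5 * q 2))"
  "coeff_mult p q 6 = 2 * p 6 * q 6 + 2 * k * p 7 * q 7"
  "coeff_mult p q 7 = 2 * p 6 * q 7 + 2 * p 7 * q 6"
  by (simp_all add: coeff_mult_def)

text \<open>Consecutive factors of D start in opposite halves, so W always meets its transpose: W
  W^T if \<open>a\<close> is an upper block, W^T W if it is a lower one.\<close>

lemma wgh_half_orthogonal:
  assumes "x < v" "y < v" "b div 2 \<noteq> a div 2" "a < 4" "b < 4"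
  shows "(\<Sum>z<v. wgh_half a x z * wgh_half b z y) = k * of_bool (x = y)"
  using less_4_cases[OF assms(4)] less_4_cases[OF assms(5)] assms(3)
    wgh_rows[OF assms(1,2)] wgh_cols[OF assms(1,2)]
  by (elim disjE; simp add: wgh_half_def)

lemma delta_wgh_half:
  assumes "x < v" "y < v"
  shows "(\<Sum>z<v. of_bool (x = z) * wgh_half a z y) = wgh_half a x y"
    and "(\<Sum>z<v. wgh_half a x z * of_bool (z = y)) = wgh_half a x y"
    and "(\<Sum>z<v. of_bool (x = z) * (of_bool (z = y) :: real)) = of_bool (x = y)"
  using assms by (simp_all add: of_bool_def if_distrib[of "\<lambda>q. q * _"] if_distrib[of "\<lambda>q. _ * q"] cong: if_cong)

text \<open>In each half the two middle blocks \<open>c\<close> have opposite parity. Terms without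
  a sign double, terms with one sign cancel, and two signs combine to twice
  \<open>parity_sign a b\<close>. The number \<open>2 - 2 * (b div 2)\<close> is a representative
  block of the half opposite to \<open>b\<close>; \<open>wgh_half\<close> depends on the half
  only.\<close>

lemma sum_algebra_kernel_blocks:
  assumes "a < 4" "b < 4"
  shows "(\<Sum>c<4. algebra_kernel p a c x z * algebra_kernel q c b z y) =
    (if a div 2 = b div 2 then
      2 * (srg_kernel (p 0) (p 1) (p 2) x z * srg_kernel (q 0) (q 1) (q 2) z y)
      + 2 * (srg_kernel (p 3) (p 4) (p 5) x z * srg_kernel (q 3) (q 4) (q 5) z y)
      + parity_sign a b * (2 * p 6 * q 6 * (of_bool (x = z) * of_bool (z = y))
         + 2 * p 7 * q 7 * (wgh_half a x z * wgh_half (2 - 2 * (b div 2)) z y))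
     else
      2 * (srg_kernel (p 0) (p 1) (p 2) x z * srg_kernel (q 3) (q 4) (q 5) z y)
      + 2 * (srg_kernel (p 3) (p 4) (p 5) x z * srg_kernel (q 0) (q 1) (q 2) z y)
      + parity_sign a b * (2 * p 6 * q 7 * (of_bool (x = z) * wgh_half a z y)
         + 2 * p 7 * q 6 * (wgh_half a x z * of_bool (z = y))))"
  using less_4_cases[OF assms(1)] less_4_cases[OF assms(2)]
  by (elim disjE; simp add: sum_lessThan_4 algebra_kernel_def parity_sign_def wgh_half_def; simp add: algebra_simps)

lemma algebra_kernel_mult:
  assumes "a < 4" "b < 4" "x < v" "y < v"
  shows "(\<Sum>z<v. \<Sum>c<4. algebra_kernel p a c x z * algebra_kernel q c b z y) = algebra_kernel (coeff_mult p q) a b x y"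
proof (cases "a div 2 = b div 2")
  case True
  have "(2 - 2 * (b div 2)) div 2 \<noteq> a div 2" "2 - 2 * (b div 2) < 4"
    using True less_4_cases[OF assms(2)] by auto
  then have wgh: "(\<Sum>z<v. wgh_half a x z * wgh_half (2 - 2 * (b div 2)) z y) = k * of_bool (x = y)"
    using wgh_half_orthogonal assms by blast
  have "(\<Sum>z<v. \<Sum>c<4. algebra_kernel p a c x z * algebra_kernel q c b z y) =
    2 * (\<Sum>z<v. srg_kernel (p 0) (p 1) (p 2) x z * srg_kernel (q 0) (q 1) (q 2) z y)
      + 2 * (\<Sum>z<v. srg_kernel (p 3) (p 4) (p 5) x z * srg_kernel (q 3) (q 4) (q 5) z y)
      + parity_sign a b * (2 * p 6 * q 6 * (\<Sum>z<v. of_bool (x = z) * of_bool (z = y))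
         + 2 * p 7 * q 7 * (\<Sum>z<v. wgh_half a x z * wgh_half (2 - 2 * (b div 2)) z y))"
    by (simp only: sum_algebra_kernel_blocks[OF assms(1,2)] True simp_thms if_True sum.distrib sum_distrib_left[symmetric])
  also have "\<dots> = algebra_kernel (coeff_mult p q) a b x y"
    unfolding wgh algebra_kernel_def if_P[OF True] srg_kernel_mult[OF assms(3,4)] delta_wgh_half(3)[OF assms(3,4)]
    unfolding coeff_mult_simps srg_kernel_def
    by (simp add: algebra_simps)
  finally show ?thesis .
next
  case False
  have "(\<Sum>z<v. \<Sum>c<4. algebra_kernel p a c x z * algebra_kernel q c b z y) =
    2 * (\<Sum>z<v. srg_kernel (p 0) (p 1) (p 2) x z * srg_kernel (q 3) (q 4) (q 5) z y)
      + 2 * (\<Sum>z<v. srg_kernel (p 3) (p 4) (p 5) x z * srg_kernel (q 0) (q 1) (q 2) z y)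
      + parity_sign a b * (2 * p 6 * q 7 * (\<Sum>z<v. of_bool (x = z) * wgh_half a z y)
         + 2 * p 7 * q 6 * (\<Sum>z<v. wgh_half a x z * of_bool (z = y)))"
    by (simp only: sum_algebra_kernel_blocks[OF assms(1,2)] False simp_thms if_False sum.distrib sum_distrib_left[symmetric])
  also have "\<dots> = algebra_kernel (coeff_mult p q) a b x y"
    unfolding algebra_kernel_def if_not_P[OF False] srg_kernel_mult[OF assms(3,4)] delta_wgh_half(1,2)[OF assms(3,4)]
    unfolding coeff_mult_simps srg_kernel_def
    by (simp add: algebra_simps)
  finally show ?thesis .
qed

section \<open>Coordinates of the scheme and of its idempotents\<close>

definition algebra_mat :: "(nat \<Rightarrow> real) \<Rightarrow> real mat" where
  "algebra_mat q = block4 v (algebra_kernel q)"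

lemma algebra_mat_carrier [simp]: "algebra_mat q \<in> carrier_mat (4 * v) (4 * v)"
  by (simp add: algebra_mat_def)

lemma algebra_mat_mult: "algebra_mat p * algebra_mat q = algebra_mat (coeff_mult p q)"
  unfolding algebra_mat_def block4_mult by (rule block4_cong) (rule algebra_kernel_mult)

lemma algebra_mat_cong:
  assumes "\<forall>i\<le>7. p i = q i"
  shows "algebra_mat p = algebra_mat q"
  using assms unfolding all_le_7 algebra_mat_def algebra_kernel_def by (simp cong: if_cong)

lemma algebra_mat_lincomb:
  "mat_lincomb (4 * v) d c (\<lambda>h. algebra_mat (f h)) = algebra_mat (\<lambda>i. \<Sum>h\<le>d. c h * f h i)"
  unfolding algebra_mat_def block4_lincomb
  by (rule block4_cong)
    (simp add: algebra_kernel_def srg_kernel_def sum_distrib_left sum_distrib_right sum.distrib algebra_simps)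

text \<open>The halves come from I_2 = (J_2 + (I_2 - Pi))/2 and from W_1 = (A + W)/2, W_2 = (A -
  W)/2; for instance I_2 (x) W_1 + Pi (x) W_2 = (J_2 (x) A + (I_2 - Pi) (x) W)/2.\<close>

definition scheme_coeff :: "nat \<Rightarrow> nat \<Rightarrow> real" where
  "scheme_coeff h = (!) ([
     [1/2, 0, 0, 0, 0, 0, 1/2, 0],
     [1/2, 0, 0, 0, 0, 0, - 1/2, 0],
     [0, 1, 0, 0, 0, 0, 0, 0],
     [- 1, - 1, 1, 0, 0, 0, 0, 0],
     [0, 0, 0, 1, 0, 0, 0, 0],
     [0, 0, 0, 0, 1/2, 0, 0, 1/2],
     [0, 0, 0, 0, 1/2, 0, 0, - 1/2],
     [0, 0, 0, - 1, - 1, 1, 0, 0]] ! h)"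

text \<open>Up to the factor 1/4, f and g are the coordinates in I, A, J of the idempotents of the strongly
  regular graph for s and t.\<close>

definition idempotent_coeff :: "nat \<Rightarrow> nat \<Rightarrow> real" where
  "idempotent_coeff h = (let u = 1 / (4 * real v); b = 1 / (4 * (s - t)); r = 1 / (4 * sqrt k);
      f1 = - t * b; f2 = - (k - t) * b / real v; g1 = s * b; g2 = (k - s) * b / real v in
    (!) ([
     [0, 0, u, 0, 0, u, 0, 0],
     [0, 0, u, 0, 0, - u, 0, 0],
     [f1, b, f2, f1, b, f2, 0, 0],
     [f1, b, f2, - f1, - b, - f2, 0, 0],
     [g1, - b, g2, g1, - b, g2, 0, 0],
     [g1, - b, g2, - g1, b, - g2, 0, 0],
     [0, 0, 0, 0, 0, 0, 1/4, r],
     [0, 0, 0, 0, 0, 0, 1/4, - r]] ! h))"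

section \<open>The eigenmatrices rewritten in terms of v\<close>

lemma div_mu_eq_v: "(k - s) * (k - t) / (k + s * t) = real v"
  and mu_neq_0: "k + s * t \<noteq> 0"
proof -
  have "(k - s) * (k - t) \<noteq> 0" using pos by auto
  then show "k + s * t \<noteq> 0" using mu_v by auto
  then show "(k - s) * (k - t) / (k + s * t) = real v" using mu_v by (simp add: field_simps)
qed

text \<open>Up to sign this is twice the valency v - 1 - k of the complementary graph:
  \<open>mu_v\<close> gives (k + st)(v - 1 - k) = -k (s + 1)(t + 1).\<close>

lemma P_simplify: "2 * k * (s + 1) * (t + 1) / (k + s * t) = - (2 * (real v - 1 - k))"
  using mu_neq_0 mu_v by (simp add: field_simps)

text \<open>Adding multiples of \<open>mu_v\<close> exposes the factor k + st in every numerator.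
  The first and third right-hand sides are the multiplicities f of s and g of t, the solutions of 1
  + f + g = v and k + fs + gt = 0.\<close>

lemma Q_simplify:
  "k * (k - t) * (t + 1) / ((t - s) * (k + s * t)) = - ((t * real v + k - t) / (s - t))"
  "k * (k - t) * (t + 1) / ((s - t) * (k + s * t)) = (t * real v + k - t) / (s - t)"
  "k * (k - s) * (s + 1) / ((s - t) * (k + s * t)) = (s * real v + k - s) / (s - t)"
  "s * (t + 1) * (t - k) / ((s - t) * (k + s * t)) = (real v - k + t) / (s - t)"
  "s * (k - t) * (t + 1) / ((s - t) * (k + s * t)) = - ((real v - k + t) / (s - t))"
  "(k - s) * (s + 1) * t / ((s - t) * (k + s * t)) = - ((real v - k + s) / (s - t))"
  "(k - s) * (k - t) / (sqrt k * (k + s * t)) = real v / sqrt k"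
proof -
  have cancel: "k * (k - t) * (t + 1) = (k + s * t) * (t * real v + k - t)"
    "k * (k - s) * (s + 1) = (k + s * t) * (s * real v + k - s)"
    "s * (t + 1) * (t - k) = (k + s * t) * (real v - k + t)"
    "s * (k - t) * (t + 1) = (k + s * t) * (- (real v - k + t))"
    "(k - s) * (s + 1) * t = (k + s * t) * (- (real v - k + s))"
    "(k - s) * (k - t) = (k + s * t) * real v"
    using mu_v arg_cong[OF mu_v, of "\<lambda>z. t * z"] arg_cong[OF mu_v, of "\<lambda>z. s * z"]
    by (simp_all add: algebra_simps)
  show "k * (k - t) * (t + 1) / ((s - t) * (k + s * t)) = (t * real v + k - t) / (s - t)"
    "k * (k - s) * (s + 1) / ((s - t) * (k + s * t)) = (s * real v + k - s) / (s - t)"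
    "s * (t + 1) * (t - k) / ((s - t) * (k + s * t)) = (real v - k + t) / (s - t)"
    "s * (k - t) * (t + 1) / ((s - t) * (k + s * t)) = - ((real v - k + t) / (s - t))"
    "(k - s) * (s + 1) * t / ((s - t) * (k + s * t)) = - ((real v - k + s) / (s - t))"
    "(k - s) * (k - t) / (sqrt k * (k + s * t)) = real v / sqrt k"
    unfolding cancel using mu_neq_0 by (simp_all add: minus_divide_left)
  then show "k * (k - t) * (t + 1) / ((t - s) * (k + s * t)) = - ((t * real v + k - t) / (s - t))"
    by (metis minus_diff_eq minus_divide_right mult_minus_left)
qed


lemma scheme_P_index:
  assumes "i \<le> 7" "j \<le> 7"
  shows "scheme_P k s t $$ (i, j) = [
     [1, 1, 2 * k, 2 * (real v - 1 - k), 2, k, k, 2 * (real v - 1 - k)],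
     [1, 1, 2 * k, 2 * (real v - 1 - k), - 2, - k, - k, - (2 * (real v - 1 - k))],
     [1, 1, 2 * s, - 2 * (s + 1), 2, s, s, - 2 * (s + 1)],
     [1, 1, 2 * s, - 2 * (s + 1), - 2, - s, - s, 2 * (s + 1)],
     [1, 1, 2 * t, - 2 * (t + 1), 2, t, t, - 2 * (t + 1)],
     [1, 1, 2 * t, - 2 * (t + 1), - 2, - t, - t, 2 * (t + 1)],
     [1, - 1, 0, 0, 0, sqrt k, - sqrt k, 0],
     [1, - 1, 0, 0, 0, - sqrt k, sqrt k, 0]] ! i ! j"
  unfolding scheme_P_def P_simplify mat_of_rows_list_def using assms by simp

lemma scheme_Q_index:
  assumes "i \<le> 7" "j \<le> 7"
  shows "scheme_Q k s t $$ (i, j) = (let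
      f = - ((t * real v + k - t) / (s - t)); g = (s * real v + k - s) / (s - t);
      fa = (real v - k + t) / (s - t); ga = - ((real v - k + s) / (s - t));
      r = real v / sqrt k in
    [[1, 1, f, f, g, g, real v, real v],
     [1, 1, f, f, g, g, - real v, - real v],
     [1, 1, fa, fa, ga, ga, 0, 0],
     [1, 1, (t - k) / (s - t), (t - k) / (s - t), (k - s) / (s - t), (k - s) / (s - t), 0, 0],
     [1, - 1, f, - f, g, - g, 0, 0],
     [1, - 1, fa, - fa, ga, - ga, r, - r],
     [1, - 1, fa, - fa, ga, - ga, - r, r],
     [1, - 1, (t - k) / (s - t), (k - t) / (s - t), (k - s) / (s - t), (s - k) / (s - t), 0, 0]] ! i ! j)"
  unfolding scheme_Q_def Q_simplify div_mu_eq_v mat_of_rows_list_def Let_def using assms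
  by simp

lemma scheme_coeff_eq_P_idempotent: "\<forall>j\<le>7. \<forall>p\<le>7. scheme_coeff j p = (\<Sum>i\<le>7. scheme_P k s t $$ (i, j) * idempotent_coeff i p)"
proof -
  \<comment> \<open>Replacing s by t + d turns the denominator s - t into the single nonzero
    variable d, which field arithmetic can cancel.\<close>
  have "s = t + (s - t)" "s - t \<noteq> 0" using pos(3) by auto
  then obtain d where d: "s = t + d" "d \<noteq> 0" by blast
  have [simp]: "d \<noteq> 0" "v \<noteq> 0" "k \<noteq> 0" using pos d by auto
  show ?thesis
    unfolding all_le_7 sum_atMost_7
    by (simp add: scheme_P_index scheme_coeff_def idempotent_coeff_def Let_def; simp add: d(1); simp add: field_simps)
qed

lemma idempotent_coeff_eq_Q_scheme:
  "\<forall>j\<le>7. \<forall>p\<le>7. idempotent_coeff j p = (\<Sum>i\<le>7. 1 / (4 * real v) * scheme_Q k s t $$ (i, j) * scheme_coeff i p)"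
proof -
  have "s = t + (s - t)" "s - t \<noteq> 0" using pos(3) by auto
  then obtain d where d: "s = t + d" "d \<noteq> 0" by blast
  have [simp]: "d \<noteq> 0" "v \<noteq> 0" "k \<noteq> 0" using pos d by auto
  show ?thesis
    unfolding all_le_7 sum_atMost_7
    by (simp add: scheme_Q_index scheme_coeff_def idempotent_coeff_def Let_def; simp add: d(1); simp add: field_simps)
qed

lemma idempotent_coeff_orthogonal:
  "\<forall>i\<le>7. \<forall>j\<le>7. \<forall>p\<le>7. coeff_mult (idempotent_coeff i) (idempotent_coeff j) p = (if i = j then idempotent_coeff i p else 0)"
proof -
  \<comment> \<open>Eliminating mu in favour of v removes the only side relation: what is left are
    rational identities in k, t, d, v and sqrt k.\<close>
  have mu: "k + s * t = (k - s) * (k - t) / real v"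
    using mu_v pos(4) by (simp add: field_simps)
  have "s = t + (s - t)" "s - t \<noteq> 0" using pos(3) by auto
  then obtain d where d: "s = t + d" "d \<noteq> 0" by blast
  have [simp]: "d \<noteq> 0" "v \<noteq> 0" "k \<noteq> 0" "0 < k" "\<bar>k\<bar> = k" using pos d by auto
  show ?thesis
    unfolding all_le_7 coeff_mult_simps mu
    by (intro conjI; simp add: idempotent_coeff_def Let_def; (simp add: d(1))?; (simp add: field_simps)?)
qed

definition scheme_idempotent :: "nat \<Rightarrow> complex mat" where
  "scheme_idempotent i = map_mat complex_of_real (algebra_mat (idempotent_coeff i))"

lemma scheme_idempotent_mult:
  assumes "i \<le> 7" "j \<le> 7"
  shows "scheme_idempotent i * scheme_idempotent j = (if i = j then scheme_idempotent i else 0\<^sub>m (4 * v) (4 * v))"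
proof -
  have "scheme_idempotent i * scheme_idempotent j = map_mat complex_of_real (algebra_mat (idempotent_coeff i) * algebra_mat (idempotent_coeff j))"
    unfolding scheme_idempotent_def by (rule of_real_hom.mat_hom_mult[symmetric]) (rule algebra_mat_carrier)+
  also have "algebra_mat (idempotent_coeff i) * algebra_mat (idempotent_coeff j) = algebra_mat (\<lambda>p. if i = j then idempotent_coeff i p else 0)"
    unfolding algebra_mat_mult by (rule algebra_mat_cong) (use idempotent_coeff_orthogonal assms in blast)
  also have "map_mat complex_of_real \<dots> = (if i = j then scheme_idempotent i else 0\<^sub>m (4 * v) (4 * v))"
  proof (cases "i = j")
    case False
    have "algebra_mat (\<lambda>p. 0) = 0\<^sub>m (4 * v) (4 * v)"
      by (rule eq_matI) (auto simp: algebra_mat_def block4_def algebra_kernel_def srg_kernel_def)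
    then show ?thesis using False by (auto intro: eq_matI)
  qed (simp add: scheme_idempotent_def)
  finally show ?thesis .
qed

lemma scheme_idempotent_0: "scheme_idempotent 0 = (1 / of_nat (4 * v)) \<cdot>\<^sub>m all_ones (4 * v)"
proof -
  have "algebra_mat (idempotent_coeff 0) = block4 v (\<lambda>a b x y. 1 / (4 * real v))"
    unfolding algebra_mat_def by (rule block4_cong) (simp add: algebra_kernel_def srg_kernel_def idempotent_coeff_def Let_def)
  then show ?thesis unfolding scheme_idempotent_def by (auto simp: block4_def all_ones_def intro!: eq_matI)
qed

lemma scheme_P_carrier: "scheme_P k s t \<in> carrier_mat 8 8"
  and scheme_Q_carrier: "scheme_Q k s t \<in> carrier_mat 8 8"
  by (rule carrier_matI; simp add: scheme_P_def scheme_Q_def mat_of_rows_list_def)+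

lemma scheme_lincomb_idempotent:
  assumes "j \<le> 7"
  shows "map_mat complex_of_real (algebra_mat (scheme_coeff j)) =
    mat_lincomb (4 * v) 7 (\<lambda>i. map_mat complex_of_real (scheme_P k s t) $$ (i, j)) scheme_idempotent"
proof -
  have "algebra_mat (scheme_coeff j) = mat_lincomb (4 * v) 7 (\<lambda>i. scheme_P k s t $$ (i, j)) (\<lambda>i. algebra_mat (idempotent_coeff i))"
    unfolding algebra_mat_lincomb by (rule algebra_mat_cong) (use scheme_coeff_eq_P_idempotent assms in blast)
  then have "map_mat complex_of_real (algebra_mat (scheme_coeff j)) =
    mat_lincomb (4 * v) 7 (\<lambda>i. complex_of_real (scheme_P k s t $$ (i, j))) scheme_idempotent"
    by (simp only: map_mat_of_real_lincomb[OF algebra_mat_carrier] scheme_idempotent_def[abs_def])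
  also have "\<dots> = mat_lincomb (4 * v) 7 (\<lambda>i. map_mat complex_of_real (scheme_P k s t) $$ (i, j)) scheme_idempotent"
    by (rule mat_lincomb_cong) (use scheme_P_carrier assms in auto)
  finally show ?thesis .
qed

lemma idempotent_lincomb_scheme:
  assumes "j \<le> 7"
  shows "scheme_idempotent j = (1 / of_nat (4 * v)) \<cdot>\<^sub>m
    mat_lincomb (4 * v) 7 (\<lambda>i. map_mat complex_of_real (scheme_Q k s t) $$ (i, j))
      (\<lambda>i. map_mat complex_of_real (algebra_mat (scheme_coeff i)))"
proof -
  have "algebra_mat (idempotent_coeff j) = mat_lincomb (4 * v) 7 (\<lambda>i. 1 / (4 * real v) * scheme_Q k s t $$ (i, j)) (\<lambda>i. algebra_mat (scheme_coeff i))"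
    unfolding algebra_mat_lincomb by (rule algebra_mat_cong) (use idempotent_coeff_eq_Q_scheme assms in blast)
  then have "scheme_idempotent j = mat_lincomb (4 * v) 7
      (\<lambda>i. complex_of_real (1 / (4 * real v) * scheme_Q k s t $$ (i, j)))
      (\<lambda>i. map_mat complex_of_real (algebra_mat (scheme_coeff i)))"
    by (simp only: map_mat_of_real_lincomb[OF algebra_mat_carrier] scheme_idempotent_def)
  also have "\<dots> = mat_lincomb (4 * v) 7
      (\<lambda>i. 1 / of_nat (4 * v) * map_mat complex_of_real (scheme_Q k s t) $$ (i, j))
      (\<lambda>i. map_mat complex_of_real (algebra_mat (scheme_coeff i)))"
    by (rule mat_lincomb_cong) (use scheme_Q_carrier assms in auto)
  finally show ?thesis unfolding smult_mat_lincomb .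
qed

lemma scheme_Q_column_nonzero:
  assumes "j \<le> 7"
  shows "\<exists>i\<le>7. map_mat complex_of_real (scheme_Q k s t) $$ (i, j) \<noteq> 0"
proof -
  \<comment> \<open>Row 0 holds the multiplicities, which in columns 2 to 5 are not visibly nonzero.
    In row 3 those columns are, up to sign, (k - t)/(s - t) and (k - s)/(s - t), nonzero because k >
    s > t.\<close>
  have "\<forall>j\<le>7. scheme_Q k s t $$ (0, j) \<noteq> 0 \<or> scheme_Q k s t $$ (3, j) \<noteq> 0"
    unfolding all_le_7 using pos by (simp add: scheme_Q_index Let_def)
  then have "scheme_Q k s t $$ (0, j) \<noteq> 0 \<or> scheme_Q k s t $$ (3, j) \<noteq> 0" using assms by blast
  then obtain i :: nat where "i \<le> 7" "scheme_Q k s t $$ (i, j) \<noteq> 0"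
    using that[of 0] that[of 3] by auto
  then show ?thesis using scheme_Q_carrier assms by (intro exI[of _ i]) auto
qed

end

section \<open>Strongly regular graphs and weighing matrices\<close>

lemma mult_mat_index:
  assumes "M \<in> carrier_mat n n" "N \<in> carrier_mat n n" "x < n" "y < n"
  shows "(M * N) $$ (x, y) = (\<Sum>z<n. M $$ (x, z) * N $$ (z, y))"
  using assms by (auto simp: scalar_prod_def lessThan_atLeast0 intro!: sum.cong)

text \<open>An eigenvector for an eigenvalue other than the valency is orthogonal to the all-ones vector,
  so the J-term of the quadratic relation vanishes on it.\<close>

lemma srg_restricted_eigenvalue:
  fixes adj :: "nat \<Rightarrow> nat \<Rightarrow> complex" and c :: complex
  assumes row: "\<And>x. x < v \<Longrightarrow> (\<Sum>z<v. adj z x) = k"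
    and sq: "\<And>x y. x < v \<Longrightarrow> y < v \<Longrightarrow>
      (\<Sum>z<v. adj x z * adj z y) = k * of_bool (x = y) + l * adj x y + m * (1 - of_bool (x = y) - adj x y)"
    and ev: "\<And>x. x < v \<Longrightarrow> (\<Sum>y<v. adj x y * w y) = c * w x"
    and nz: "x0 < v" "w x0 \<noteq> 0" and ck: "c \<noteq> k"
  shows "c * c = (l - m) * c + (k - m)"
proof -
  \<comment> \<open>The coordinates of A w are summed twice: by the column sums of A and by the
    eigenvalue equation.\<close>
  have "(\<Sum>x<v. \<Sum>y<v. adj x y * w y) = k * (\<Sum>y<v. w y)"
    by (subst sum.swap) (simp add: row sum_distrib_left flip: sum_distrib_right)
  moreover have "(\<Sum>x<v. \<Sum>y<v. adj x y * w y) = c * (\<Sum>y<v. w y)"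
    by (simp add: ev sum_distrib_left)
  ultimately have w0: "(\<Sum>y<v. w y) = 0" using ck by (metis mult_right_cancel)
  have delta: "(\<Sum>y<v. of_bool (x0 = y) * w y) = w x0"
    using nz(1) by (simp add: of_bool_def if_distrib[of "\<lambda>q. q * _"] cong: if_cong)
  have "c * c * w x0 = (\<Sum>z<v. adj x0 z * (\<Sum>y<v. adj z y * w y))"
  proof -
    have "(\<Sum>z<v. adj x0 z * (\<Sum>y<v. adj z y * w y)) = (\<Sum>z<v. c * (adj x0 z * w z))"
      by (intro sum.cong refl) (simp add: ev)
    also have "\<dots> = c * (c * w x0)"
      unfolding sum_distrib_left[symmetric] ev[OF nz(1)] ..
    finally show ?thesis by simp
  qed
  also have "\<dots> = (\<Sum>y<v. (\<Sum>z<v. adj x0 z * adj z y) * w y)"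
    unfolding sum_distrib_left sum_distrib_right by (subst sum.swap) (simp add: mult.assoc)
  also have "\<dots> = (\<Sum>y<v. (k - m) * (of_bool (x0 = y) * w y) + (l - m) * (adj x0 y * w y) + m * w y)"
  proof (intro sum.cong refl)
    fix y assume "y \<in> {..<v}"
    then have "y < v" by simp
    show "(\<Sum>z<v. adj x0 z * adj z y) * w y =
      (k - m) * (of_bool (x0 = y) * w y) + (l - m) * (adj x0 y * w y) + m * w y"
      unfolding sq[OF nz(1) \<open>y < v\<close>] by (simp add: algebra_simps)
  qed
  also have "\<dots> = (k - m) * w x0 + (l - m) * (c * w x0)"
    by (simp only: sum.distrib sum_distrib_left[symmetric] delta w0 ev[OF nz(1)]) simp
  finally have "(c * c - ((l - m) * c + (k - m))) * w x0 = 0" by (simp add: algebra_simps)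
  then show ?thesis using nz(2) by simp
qed

lemma spectrum_eigenvector:
  fixes M :: "complex mat"
  assumes "M \<in> carrier_mat n n" "c \<in> spectrum M"
  obtains w x0 where "x0 < n" "w x0 \<noteq> 0" "\<And>x. x < n \<Longrightarrow> (\<Sum>y<n. M $$ (x, y) * w y) = c * w x"
proof -
  obtain u where u: "u \<in> carrier_vec n" "u \<noteq> 0\<^sub>v n" "M *\<^sub>v u = c \<cdot>\<^sub>v u"
    using assms unfolding spectrum_def eigenvalue_def eigenvector_def by auto
  obtain x0 where x0: "x0 < n" "u $ x0 \<noteq> 0"
    using u(1,2) by (metis carrier_vecD eq_vecI index_zero_vec)
  have "(\<Sum>y<n. M $$ (x, y) * u $ y) = c * u $ x" if "x < n" for x
    using arg_cong[OF u(3), of "\<lambda>z. z $ x"] assms(1) u(1) that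
    by (auto simp: scalar_prod_def lessThan_atLeast0)
  then show ?thesis using that[of x0 "\<lambda>y. u $ y"] x0 by blast
qed

text \<open>Both s and t differ from k, hence are roots of c^2 = (l - m) c + (k - m). By Vieta s + t
  = l - m and st = m - k, which expresses the quadratic relation of the graph through its
  eigenvalues, with m = k + st.\<close>

lemma srg_parameters:
  fixes A :: "int mat" and s t :: real
  assumes srg: "strongly_regular_graph v k l m G" and A: "A = adjacency_matrix v G"
    and spec: "spectrum (complex_mat A) = {complex_of_nat k, complex_of_real s, complex_of_real t}"
    and "real k > s" "s > t"
  shows "\<And>x y. x < v \<Longrightarrow> y < v \<Longrightarrow> A $$ (x, y) = A $$ (y, x)"
    and "\<And>x. x < v \<Longrightarrow> A $$ (x, x) = 0"
    and "\<And>x. x < v \<Longrightarrow> (\<Sum>z<v. A $$ (x, z)) = int k"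
    and "\<And>x y. x < v \<Longrightarrow> y < v \<Longrightarrow>
      (\<Sum>z<v. real_of_int (A $$ (x, z)) * real_of_int (A $$ (z, y)))
        = - (s * t) * of_bool (x = y) + (s + t) * real_of_int (A $$ (x, y)) + (real k + s * t)"
    and "(real k + s * t) * real v = (real k - s) * (real k - t)"
    and "0 < k" and "0 < v"
proof -
  have car: "A \<in> carrier_mat v v" using A by (simp add: adjacency_matrix_def)
  have sg: "simple_graph v G" and
    sq: "A * A = int k \<cdot>\<^sub>m 1\<^sub>m v + int l \<cdot>\<^sub>m A + int m \<cdot>\<^sub>m (all_ones v - 1\<^sub>m v - A)"
    and nz: "A \<noteq> 0\<^sub>m v v"
    using srg unfolding strongly_regular_graph_def A Let_def by auto
  have val: "A $$ (x, y) = of_bool ((x, y) \<in> G)" if "x < v" "y < v" for x y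
    using that A by (simp add: adjacency_matrix_def)
  show sym: "A $$ (x, y) = A $$ (y, x)" if "x < v" "y < v" for x y
    using val that sg by (auto simp: simple_graph_def sym_def of_bool_def)
  show diag: "A $$ (x, x) = 0" if "x < v" for x
    using val that sg by (auto simp: simple_graph_def irrefl_def)
  have sqi: "(\<Sum>z<v. A $$ (x, z) * A $$ (z, y)) =
      int k * of_bool (x = y) + int l * A $$ (x, y) + int m * (1 - of_bool (x = y) - A $$ (x, y))"
    if "x < v" "y < v" for x y
    using mult_mat_index[OF car car that] that car unfolding sq by auto
  show row: "(\<Sum>z<v. A $$ (x, z)) = int k" if "x < v" for x
  proof -
    \<comment> \<open>Entries 0 and 1 equal their squares, so the row sum is a diagonal entry of
      A^2; regularity is thus a consequence of the matrix equation.\<close>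
    have "(\<Sum>z<v. A $$ (x, z)) = (\<Sum>z<v. A $$ (x, z) * A $$ (z, x))"
      using that by (intro sum.cong refl) (simp add: sym[of _ x] val[of x])
    then show ?thesis using sqi[OF that that] diag[OF that] by simp
  qed
  obtain x0 y0 where xy0: "x0 < v" "y0 < v" "A $$ (x0, y0) \<noteq> 0"
    using car nz by (metis carrier_matD eq_matI index_zero_mat)
  then show v0: "0 < v" by simp
  show k0: "0 < k"
  proof (rule ccontr)
    assume "\<not> 0 < k"
    then have "(\<Sum>z<v. A $$ (x0, z)) = 0" using row[OF xy0(1)] by simp
    then have "A $$ (x0, y0) = 0"
      using xy0 val by (subst (asm) sum_nonneg_eq_0_iff) (auto simp: val)
    then show False using xy0 by simp
  qed
  have quad: "c * c = (real l - real m) * c + (real k - real m)"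
    if c: "complex_of_real c \<in> spectrum (complex_mat A)" "c \<noteq> real k" for c
  proof -
    obtain w x0 where w: "x0 < v" "w x0 \<noteq> 0"
      "\<And>x. x < v \<Longrightarrow> (\<Sum>y<v. complex_mat A $$ (x, y) * w y) = complex_of_real c * w x"
    proof -
      have "complex_mat A \<in> carrier_mat v v" using car by simp
      from spectrum_eigenvector[OF this c(1)] show ?thesis using that by blast
    qed
    have "complex_of_real c * complex_of_real c = (of_nat l - of_nat m) * complex_of_real c + (of_nat k - of_nat m)"
    proof (rule srg_restricted_eigenvalue[where adj="\<lambda>x y. complex_of_int (A $$ (x, y))"])
      show "(\<Sum>z<v. complex_of_int (A $$ (z, x))) = of_nat k" if "x < v" for x
      proof -
        have "(\<Sum>z<v. A $$ (z, x)) = int k" using row[OF that] sym that by simp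
        then show ?thesis by (metis of_int_of_nat_eq of_int_sum)
      qed
      show "(\<Sum>z<v. complex_of_int (A $$ (x, z)) * complex_of_int (A $$ (z, y))) =
        of_nat k * of_bool (x = y) + of_nat l * complex_of_int (A $$ (x, y))
        + of_nat m * (1 - of_bool (x = y) - complex_of_int (A $$ (x, y)))" if "x < v" "y < v" for x y
        using arg_cong[OF sqi[OF that], of complex_of_int] by simp
      show "(\<Sum>y<v. complex_of_int (A $$ (x, y)) * w y) = complex_of_real c * w x" if "x < v" for x
        using w(3)[OF that] that car by simp
      show "complex_of_real c \<noteq> of_nat k" using c(2) by (metis of_real_eq_iff of_real_of_nat_eq)
    qed (use w in auto)
    then have "complex_of_real (c * c) = complex_of_real ((real l - real m) * c + (real k - real m))"
      by simp
    then show ?thesis by (simp only: of_real_eq_iff)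
  qed
  have qs: "s * s = (real l - real m) * s + (real k - real m)"
    by (rule quad) (use spec assms(4) in auto)
  have qt: "t * t = (real l - real m) * t + (real k - real m)"
    by (rule quad) (use spec assms(4,5) in auto)
  have "(s - t) * (s + t) = (s - t) * (real l - real m)" using qs qt by (simp add: algebra_simps)
  then have st: "s + t = real l - real m" using assms(5) by simp
  have mu: "real m = real k + s * t"
  proof -
    have "s * s = (s + t) * s + (real k - real m)" using qs st by simp
    then show ?thesis by (simp add: algebra_simps)
  qed
  show "(\<Sum>z<v. real_of_int (A $$ (x, z)) * real_of_int (A $$ (z, y)))
        = - (s * t) * of_bool (x = y) + (s + t) * real_of_int (A $$ (x, y)) + (real k + s * t)"
    if "x < v" "y < v" for x y
  proof -
    have "(\<Sum>z<v. real_of_int (A $$ (x, z)) * real_of_int (A $$ (z, y))) =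
      real k * of_bool (x = y) + real l * real_of_int (A $$ (x, y))
        + real m * (1 - of_bool (x = y) - real_of_int (A $$ (x, y)))"
      using arg_cong[OF sqi[OF that], of real_of_int] by simp
    also have "real l = s + t + real m" using st by simp
    finally show ?thesis unfolding mu by (simp add: algebra_simps)
  qed
  \<comment> \<open>Row \<open>x0\<close> of A^2 is summed twice, by regularity and by the quadratic
    relation; the comparison gives mu v = (k - s)(k - t).\<close>
  have "(\<Sum>y<v. \<Sum>z<v. A $$ (x0, z) * A $$ (z, y)) = int k * int k"
    by (subst sum.swap) (simp add: row xy0 flip: sum_distrib_left sum_distrib_right)
  moreover have "(\<Sum>y<v. \<Sum>z<v. A $$ (x0, z) * A $$ (z, y)) =
     (\<Sum>y<v. (int k - int m) * of_bool (x0 = y) + (int l - int m) * A $$ (x0, y) + int m)"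
  proof (intro sum.cong refl)
    fix y assume "y \<in> {..<v}"
    then have "y < v" by simp
    show "(\<Sum>z<v. A $$ (x0, z) * A $$ (z, y)) =
      (int k - int m) * of_bool (x0 = y) + (int l - int m) * A $$ (x0, y) + int m"
      unfolding sqi[OF xy0(1) \<open>y < v\<close>] by (simp add: algebra_simps)
  qed
  moreover have "\<dots> = (int k - int m) + (int l - int m) * int k + int v * int m"
    using row[OF xy0(1)] xy0(1) by (simp add: sum.distrib of_bool_def flip: sum_distrib_left)
  ultimately have "real_of_int (int k * int k) = real_of_int ((int k - int m) + (int l - int m) * int k + int v * int m)"
    by simp
  then have "real k * real k = real k - real m + (real l - real m) * real k + real v * real m" by simp
  then have "real k * real k = real k - real m + (s + t) * real k + real v * real m"
    by (simp only: st)
  then show "(real k + s * t) * real v = (real k - s) * (real k - t)"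
    by (simp add: mu algebra_simps)
qed

text \<open>A right inverse of a square matrix is also a left inverse. The right inverse (1/w) W^T
  has fractional entries, hence the passage to the reals and the need for
  \<open>0 < w\<close>.\<close>

lemma weighing_matrix_columns:
  assumes "weighing_matrix v w W" "0 < w"
  shows "transpose_mat W * W = int w \<cdot>\<^sub>m 1\<^sub>m v"
proof -
  have car: "W \<in> carrier_mat v v" and WW: "W * transpose_mat W = int w \<cdot>\<^sub>m 1\<^sub>m v"
    using assms(1) by (auto simp: weighing_matrix_def)
  define R where "R = map_mat real_of_int W"
  have R: "R \<in> carrier_mat v v" "transpose_mat R \<in> carrier_mat v v" using car by (auto simp: R_def)
  have RT: "transpose_mat R = map_mat real_of_int (transpose_mat W)" by (auto simp: R_def)
  have "R * transpose_mat R = map_mat real_of_int (W * transpose_mat W)"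
    unfolding RT unfolding R_def
    by (rule of_int_hom.mat_hom_mult[symmetric, of _ v v _ v]) (use car in auto)
  also have "\<dots> = real w \<cdot>\<^sub>m 1\<^sub>m v" unfolding WW by (auto intro!: eq_matI)
  finally have "R * transpose_mat R = real w \<cdot>\<^sub>m 1\<^sub>m v" .
  then have "R * ((1 / real w) \<cdot>\<^sub>m transpose_mat R) = 1\<^sub>m v"
    using assms(2) by (subst mult_smult_distrib[OF R]) (auto intro!: eq_matI)
  then have "((1 / real w) \<cdot>\<^sub>m transpose_mat R) * R = 1\<^sub>m v"
    using mat_mult_left_right_inverse[OF R(1)] R(2) by simp
  then have inv: "(1 / real w) \<cdot>\<^sub>m (transpose_mat R * R) = 1\<^sub>m v"
    by (subst (asm) mult_smult_assoc_mat[OF R(2) R(1)])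
  have RR: "transpose_mat R * R = map_mat real_of_int (transpose_mat W * W)"
    unfolding RT unfolding R_def
    by (rule of_int_hom.mat_hom_mult[symmetric, of _ v v _ v]) (use car in auto)
  show ?thesis
  proof (rule eq_matI)
    fix x y assume "x < dim_row (int w \<cdot>\<^sub>m 1\<^sub>m v)" "y < dim_col (int w \<cdot>\<^sub>m 1\<^sub>m v)"
    then have xy: "x < v" "y < v" by auto
    have "1 / real w * real_of_int ((transpose_mat W * W) $$ (x, y)) = of_bool (x = y)"
      using arg_cong[OF inv, of "\<lambda>M. M $$ (x, y)"] xy car unfolding RR by (simp del: index_mult_mat(1))
    then have "real_of_int ((transpose_mat W * W) $$ (x, y)) = real_of_int (int w * of_bool (x = y))"
      using assms(2) by (simp add: field_simps split: if_splits)
    then show "(transpose_mat W * W) $$ (x, y) = (int w \<cdot>\<^sub>m 1\<^sub>m v) $$ (x, y)"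
      using xy by (simp only: of_int_eq_iff) simp
  qed (use car in auto)
qed

theorem theorem4p1:
  fixes v w k l m :: nat and s t :: real
    and W W1 W2 A :: "int mat" and G :: "(nat \<times> nat) set"
  assumes "weighing_matrix v w W" and "quasi_balanced v W"
    and "strongly_regular_graph v k l m G"
    and "A = adjacency_matrix v G" and "abs_mat W = A"
    and "spectrum (complex_mat A) = {complex_of_nat k, complex_of_real s, complex_of_real t}"
    and "real k > s" and "s > t"
    and "zero_one_matrix v W1" and "zero_one_matrix v W2"
    and "disjoint_matrices v W1 W2" and "W = W1 - W2"
  shows "symmetric_association_scheme (4 * v) 7 (scheme_matrices v A W1 W2) \<and>
    (\<exists>E. primitive_idempotent_basis (4 * v) 7 (scheme_matrices v A W1 W2) E \<and>
         first_eigenmatrix (4 * v) 7 (scheme_matrices v A W1 W2) E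
           (map_mat complex_of_real (scheme_P (real k) s t)) \<and>
         second_eigenmatrix (4 * v) 7 (scheme_matrices v A W1 W2) E
           (map_mat complex_of_real (scheme_Q (real k) s t)))"
proof -
  define S where "S = scheme_matrices v A W1 W2"
  have carA: "A \<in> carrier_mat v v" using assms(4) by (simp add: adjacency_matrix_def)
  have carW: "W \<in> carrier_mat v v" and WW: "W * transpose_mat W = int w \<cdot>\<^sub>m 1\<^sub>m v"
    using assms(1) by (auto simp: weighing_matrix_def)
  have car12: "W1 \<in> carrier_mat v v" "W2 \<in> carrier_mat v v"
    using assms(9,10) by (auto simp: zero_one_matrix_def)
  note par = srg_parameters[OF assms(3,4,6,7,8)]
  have W12: "W1 $$ (x, y) \<in> {0, 1}" "W2 $$ (x, y) \<in> {0, 1}" "W1 $$ (x, y) = 0 \<or> W2 $$ (x, y) = 0"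
    and Wval: "W $$ (x, y) = W1 $$ (x, y) - W2 $$ (x, y)"
    and Aabs: "A $$ (x, y) = \<bar>W $$ (x, y)\<bar>"
    if "x < v" "y < v" for x y
  proof -
    show "W1 $$ (x, y) \<in> {0, 1}" "W2 $$ (x, y) \<in> {0, 1}"
      using zero_one_matrix_index[OF assms(9) that] zero_one_matrix_index[OF assms(10) that] by auto
    show "W1 $$ (x, y) = 0 \<or> W2 $$ (x, y) = 0"
      using assms(11) that unfolding disjoint_matrices_def by blast
    show "W $$ (x, y) = W1 $$ (x, y) - W2 $$ (x, y)" using assms(12) that car12 by simp
    show "A $$ (x, y) = \<bar>W $$ (x, y)\<bar>" using assms(5) that carW by (auto simp: abs_mat_def)
  qed
  \<comment> \<open>Disjointness turns the absolute value of the difference into the sum.\<close>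
  have Asum: "A $$ (x, y) = W1 $$ (x, y) + W2 $$ (x, y)" if "x < v" "y < v" for x y
    using W12[OF that] Wval[OF that] Aabs[OF that] by auto
  have A01: "A $$ (x, y) \<in> {0, 1}" if "x < v" "y < v" for x y
    using W12[OF that] Asum[OF that] by auto
  have rows: "(\<Sum>z<v. W $$ (x, z) * W $$ (y, z)) = int w * of_bool (x = y)" if "x < v" "y < v" for x y
  proof -
    have "(\<Sum>z<v. W $$ (x, z) * W $$ (y, z)) = (W * transpose_mat W) $$ (x, y)"
      using mult_mat_index[of W v "transpose_mat W" x y] carW that by simp
    then show ?thesis unfolding WW using that by simp
  qed
  \<comment> \<open>The square of an entry of W is its absolute value, so the weight and the valency
    both count the nonzero entries of row 0, which exists since \<open>0 < v\<close>.\<close>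
  have wk: "w = k"
  proof -
    have "int w = (\<Sum>z<v. W $$ (0, z) * W $$ (0, z))" using rows par(7) by simp
    also have "\<dots> = (\<Sum>z<v. A $$ (0, z))"
    proof (rule sum.cong)
      fix z assume "z \<in> {..<v}"
      then have z: "0 < v" "z < v" by auto
      show "W $$ (0, z) * W $$ (0, z) = A $$ (0, z)"
        using W12[OF z] Wval[OF z] Asum[OF z] by auto
    qed simp
    also have "\<dots> = int k" using par(3,7) by blast
    finally show ?thesis by simp
  qed
  have cols: "(\<Sum>z<v. W $$ (z, x) * W $$ (z, y)) = int w * of_bool (x = y)" if "x < v" "y < v" for x y
  proof -
    have "(\<Sum>z<v. W $$ (z, x) * W $$ (z, y)) = (transpose_mat W * W) $$ (x, y)"
      using mult_mat_index[of "transpose_mat W" v W x y] carW that by simp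
    also have "\<dots> = int w * of_bool (x = y)"
      using weighing_matrix_columns[OF assms(1)] par(6) wk that by simp
    finally show ?thesis .
  qed
  interpret srg_weighing_kernel v "\<lambda>x y. real_of_int (A $$ (x, y))" "\<lambda>x y. real_of_int (W $$ (x, y))" "real k" s t
  proof
    show row: "(\<Sum>z<v. real_of_int (A $$ (x, z))) = real k" if "x < v" for x
      using arg_cong[OF par(3)[OF that], of real_of_int] by simp
    show "(\<Sum>z<v. real_of_int (A $$ (z, y))) = real k" if "y < v" for y
    proof -
      have "(\<Sum>z<v. real_of_int (A $$ (z, y))) = (\<Sum>z<v. real_of_int (A $$ (y, z)))"
        by (intro sum.cong refl arg_cong[of _ _ real_of_int] par(1)) (use that in auto)
      then show ?thesis using row[OF that] by simp
    qed
    show "(\<Sum>z<v. real_of_int (W $$ (x, z)) * real_of_int (W $$ (y, z))) = real k * of_bool (x = y)"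
      if "x < v" "y < v" for x y
      using arg_cong[OF rows[OF that], of real_of_int] wk by simp
    show "(\<Sum>z<v. real_of_int (W $$ (z, x)) * real_of_int (W $$ (z, y))) = real k * of_bool (x = y)"
      if "x < v" "y < v" for x y
      using arg_cong[OF cols[OF that], of real_of_int] wk by simp
  qed (use par(4-7) assms(7,8) in auto)
  have S: "S h = block4 v (scheme_kernel A W1 W2 h)" if "h \<le> 7" for h
    unfolding S_def by (rule scheme_matrices_eq_block4) (use carA car12 that in auto)
  \<comment> \<open>Although W_1 and W_2 may be asymmetric, their sum A is symmetric. Hence W_1^T +
    W_2^T = A in the lower left half, as the total J and the coordinates of A_5 and A_6
    require.\<close>
  have Asum': "W1 $$ (y, x) = W1 $$ (x, y) + W2 $$ (x, y) - W2 $$ (y, x)" if "x < v" "y < v" for x y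
    using par(1)[OF that] unfolding Asum[OF that] Asum[OF that(2,1)] by simp
  have symA: "real_of_int (W1 $$ (x, y)) + real_of_int (W2 $$ (x, y)) =
      real_of_int (W1 $$ (y, x)) + real_of_int (W2 $$ (y, x))" if "x < v" "y < v" for x y
    using par(1)[OF that] unfolding Asum[OF that] Asum[OF that(2,1)] by (metis of_int_add)
  have Salpha: "complex_mat (S h) = map_mat complex_of_real (algebra_mat (scheme_coeff h))" if "h \<le> 7" for h
  proof -
    have "\<forall>h\<le>7. of_int (scheme_kernel A W1 W2 h a b x y) = algebra_kernel (scheme_coeff h) a b x y"
      if "a < 4" "b < 4" and xy: "x < v" "y < v" for a b x y
      unfolding all_le_7 scheme_kernel_simps algebra_kernel_def
      using symA[OF xy]
      by (auto simp: scheme_coeff_def srg_kernel_def parity_sign_def wgh_half_def Wval[OF xy] Wval[OF xy(2,1)] Asum[OF xy] field_simps)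
    then show ?thesis
      unfolding S[OF that] algebra_mat_def block4_map by (intro block4_cong) (metis of_real_of_int_eq that)
  qed
  \<comment> \<open>On the diagonal the value is 0 rather than -1 because the graph has no
    loops.\<close>
  have C01: "1 - of_bool (x = y) - A $$ (x, y) \<in> {0, 1}" if "x < v" "y < v" for x y
    using A01[OF that] par(2)[of x] that by auto
  have zo: "zero_one_matrix (4 * v) (S h)" if "h \<le> 7" for h
  proof -
    have "\<forall>h\<le>7. scheme_kernel A W1 W2 h a b x y \<in> {0, 1}" if "x < v" "y < v" for a b x y
      unfolding all_le_7 scheme_kernel_simps
      using A01[OF that] C01[OF that] W12[OF that] W12[OF that(2,1)] by auto
    then show ?thesis unfolding S[OF that] by (intro zero_one_matrix_block4) (use that in blast)
  qed
  obtain x0 y0 where xy0: "x0 < v" "y0 < v" "A $$ (x0, y0) \<noteq> 0"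
    using assms(3,4) carA unfolding strongly_regular_graph_def Let_def
    by (metis carrier_matD eq_matI index_zero_mat)
  obtain x1 y1 where xy1: "x1 < v" "y1 < v" "1 - of_bool (x1 = y1) - A $$ (x1, y1) \<noteq> 0"
  proof -
    have "all_ones v - 1\<^sub>m v - A \<noteq> 0\<^sub>m v v" "all_ones v - 1\<^sub>m v - A \<in> carrier_mat v v"
      using assms(3,4) minus_carrier_mat[OF carA] unfolding strongly_regular_graph_def Let_def by auto
    then obtain x y where xy: "x < v" "y < v" "(all_ones v - 1\<^sub>m v - A) $$ (x, y) \<noteq> 0"
      by (metis carrier_matD eq_matI index_zero_mat)
    then have "1 - of_bool (x = y) - A $$ (x, y) \<noteq> 0" using carA by (auto split: if_splits)
    then show ?thesis using that xy by blast
  qed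
  have W0: "W1 $$ (x0, y0) \<noteq> 0 \<or> W2 $$ (x0, y0) \<noteq> 0" using Asum xy0 by auto
  have nz0: "S 0 \<noteq> 0\<^sub>m (4 * v) (4 * v)"
    by (subst S, simp) (rule block4_neq_0[of 0 0 x0 v x0], unfold scheme_kernel_simps, use xy0 xy1 in auto)
  have nz1: "S 1 \<noteq> 0\<^sub>m (4 * v) (4 * v)"
    by (subst S, simp) (rule block4_neq_0[of 0 1 x0 v x0], unfold scheme_kernel_simps, use xy0 xy1 in auto)
  have nz2: "S 2 \<noteq> 0\<^sub>m (4 * v) (4 * v)"
    by (subst S, simp) (rule block4_neq_0[of 0 0 x0 v y0], unfold scheme_kernel_simps, use xy0 xy1 in auto)
  have nz3: "S 3 \<noteq> 0\<^sub>m (4 * v) (4 * v)"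
    by (subst S, simp) (rule block4_neq_0[of 0 0 x1 v y1], unfold scheme_kernel_simps, use xy0 xy1 in auto)
  have nz4: "S 4 \<noteq> 0\<^sub>m (4 * v) (4 * v)"
    by (subst S, simp) (rule block4_neq_0[of 0 2 x0 v x0], unfold scheme_kernel_simps, use xy0 xy1 in auto)
  \<comment> \<open>Block (0, 2) of A_5 is W_1 and block (0, 3) is W_2; at an edge one of them is
    nonzero, which decides the block. For A_6 the two blocks change places.\<close>
  have nz5: "S 5 \<noteq> 0\<^sub>m (4 * v) (4 * v)"
    using W0
  proof
    assume "W1 $$ (x0, y0) \<noteq> 0"
    with xy0 show ?thesis
      by (subst S, simp) (intro block4_neq_0[of 0 2 x0 v y0], unfold scheme_kernel_simps, use xy0 in auto)
  next
    assume "W2 $$ (x0, y0) \<noteq> 0"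
    with xy0 show ?thesis
      by (subst S, simp) (intro block4_neq_0[of 0 3 x0 v y0], unfold scheme_kernel_simps, use xy0 in auto)
  qed
  have nz6: "S 6 \<noteq> 0\<^sub>m (4 * v) (4 * v)"
    using W0
  proof
    assume "W1 $$ (x0, y0) \<noteq> 0"
    with xy0 show ?thesis
      by (subst S, simp) (intro block4_neq_0[of 0 3 x0 v y0], unfold scheme_kernel_simps, use xy0 in auto)
  next
    assume "W2 $$ (x0, y0) \<noteq> 0"
    with xy0 show ?thesis
      by (subst S, simp) (intro block4_neq_0[of 0 2 x0 v y0], unfold scheme_kernel_simps, use xy0 in auto)
  qed
  have nz7: "S 7 \<noteq> 0\<^sub>m (4 * v) (4 * v)"
    by (subst S, simp) (rule block4_neq_0[of 0 2 x1 v y1], unfold scheme_kernel_simps, use xy0 xy1 in auto)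
  have nz: "S h \<noteq> 0\<^sub>m (4 * v) (4 * v)" if "h \<le> 7" for h
    using le_7_cases[OF that] nz0 nz1 nz2 nz3 nz4 nz5 nz6 nz7 by auto
  have id: "S 0 = 1\<^sub>m (4 * v)"
    unfolding S[of 0, simplified] one_mat_eq_block4 scheme_kernel_simps
    by (rule block4_cong) (auto dest!: less_4_cases)
  have tot: "mat_lincomb (4 * v) 7 (\<lambda>_. 1) S = all_ones (4 * v)"
  proof -
    have "mat_lincomb (4 * v) 7 (\<lambda>_. 1) S = mat_lincomb (4 * v) 7 (\<lambda>_. 1) (\<lambda>h. block4 v (scheme_kernel A W1 W2 h))"
      by (rule mat_lincomb_cong) (simp_all add: S)
    also have "\<dots> = all_ones (4 * v)"
      unfolding block4_lincomb all_ones_eq_block4 sum_atMost_7 scheme_kernel_simps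
    proof (rule block4_cong, goal_cases)
      case (1 a b x y)
      then show ?case using Asum[of x y] Asum'[of x y] by auto
    qed
    finally show ?thesis .
  qed
  have sym: "transpose_mat (S h) = S h" if "h \<le> 7" for h
  proof -
    \<comment> \<open>Off the diagonal halves, exchanging \<open>a\<close> and \<open>b\<close>
      flips the test for the upper half, and the transposition built into the kernel undoes the
      exchange of \<open>x\<close> and \<open>y\<close>.\<close>
    have "\<forall>h\<le>7. scheme_kernel A W1 W2 h b a y x = scheme_kernel A W1 W2 h a b x y"
      if "a < 4" "b < 4" "x < v" "y < v" for a b x y
      unfolding all_le_7 scheme_kernel_simps 
      using par(1)[OF that(3,4)] less_4_cases[OF that(1)] less_4_cases[OF that(2)]
      by (elim disjE) auto
    then show ?thesis unfolding S[OF that] block4_transpose by (intro block4_cong) (use that in blast)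
  qed
  have P: "first_eigenmatrix (4 * v) 7 S scheme_idempotent (map_mat complex_of_real (scheme_P (real k) s t))"
    unfolding first_eigenmatrix_def using Salpha scheme_lincomb_idempotent scheme_P_carrier by simp
  have Q: "second_eigenmatrix (4 * v) 7 S scheme_idempotent (map_mat complex_of_real (scheme_Q (real k) s t))"
    unfolding second_eigenmatrix_def
  proof (intro conjI allI impI)
    fix j :: nat assume j: "j \<le> 7"
    show "scheme_idempotent j = (1 / of_nat (4 * v)) \<cdot>\<^sub>m
      mat_lincomb (4 * v) 7 (\<lambda>i. map_mat complex_of_real (scheme_Q (real k) s t) $$ (i, j)) (\<lambda>i. complex_mat (S i))"
      unfolding idempotent_lincomb_scheme[OF j] by (rule arg_cong[OF mat_lincomb_cong]) (simp_all add: Salpha)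
  qed (use scheme_Q_carrier in simp)
  have "symmetric_association_scheme (4 * v) 7 S \<and> primitive_idempotent_basis (4 * v) 7 S scheme_idempotent"
    by (rule association_scheme_of_eigenmatrices[OF zo nz id tot sym P Q scheme_idempotent_mult scheme_idempotent_0 scheme_Q_column_nonzero])
  then show ?thesis using P Q unfolding S_def by blast
qed

end
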